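(* Let $X=\ell_2$ (complex). A typical $T\in(\mathcal B_1(X),\mathrm{SOT}^* )$ does not commute with any non-zero compact operator on $X$.
   Context: $\mathcal B_1(X)$ is the set of all bounded linear operators $T$ on $X$ with $\|T\|\le 1$. $\mathrm{SOT}^*$ (Strong$^*$ Operator Topology) is the topology of pointwise norm convergence of operators and of their adjoints: $T_i\to T$ iff $T_ix\to Tx$ in norm for all $x\in X$ and $T_i^*x^*\to T^*x^*$ in norm for all $x^*\in X^*$; $(\mathcal B_1(X),\mathrm{SOT}^* )$ is a Polish space. "A typical $T\in(\mathcal B_1(X),\mathrm{SOT}^* )$ satisfies (P)" means that the set of $T\in\mathcal B_1(X)$ satisfying (P) is comeager, i.e. contains a dense $G_\delta$ subset of $(\mathcal B_1(X),\mathrm{SOT}^* )$. *)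

theory Defs
  imports "HOL-Analysis.Analysis"
begin

typedef ell2 = "{x :: nat \<Rightarrow> complex. summable (\<lambda>n. (cmod (x n))\<^sup>2)}"
  by (rule exI[of _ "\<lambda>_. 0"]) simp

setup_lifting type_definition_ell2

lemma summable_ell2_add:
  fixes x y :: "nat \<Rightarrow> complex"
  assumes "summable (\<lambda>n. (cmod (x n))\<^sup>2)" "summable (\<lambda>n. (cmod (y n))\<^sup>2)"
  shows "summable (\<lambda>n. (cmod (x n + y n))\<^sup>2)"
proof (rule summable_comparison_test')
  show "summable (\<lambda>n. 2 * (cmod (x n))\<^sup>2 + 2 * (cmod (y n))\<^sup>2)"
    using assms by (intro summable_add summable_mult)
  fix n
  have "(cmod (x n + y n))\<^sup>2 \<le> (cmod (x n) + cmod (y n))\<^sup>2"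
    by (simp add: norm_triangle_ineq power_mono)
  also have "\<dots> \<le> 2 * (cmod (x n))\<^sup>2 + 2 * (cmod (y n))\<^sup>2"
    using sum_squares_bound[of "cmod (x n)" "cmod (y n)"] by (simp add: power2_sum)
  finally show "norm ((cmod (x n + y n))\<^sup>2) \<le> 2 * (cmod (x n))\<^sup>2 + 2 * (cmod (y n))\<^sup>2"
    by simp
qed

lemma summable_ell2_inner:
  fixes x y :: "nat \<Rightarrow> complex"
  assumes "summable (\<lambda>n. (cmod (x n))\<^sup>2)" "summable (\<lambda>n. (cmod (y n))\<^sup>2)"
  shows "summable (\<lambda>n. x n \<bullet> y n)"
proof (rule summable_comparison_test')
  show "summable (\<lambda>n. (cmod (x n))\<^sup>2 + (cmod (y n))\<^sup>2)"
    using assms by (intro summable_add)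
  fix n
  have "\<bar>x n \<bullet> y n\<bar> \<le> cmod (x n) * cmod (y n)"
    by (rule Cauchy_Schwarz_ineq2)
  also have "\<dots> \<le> 2 * cmod (x n) * cmod (y n)"
    by simp
  also have "\<dots> \<le> (cmod (x n))\<^sup>2 + (cmod (y n))\<^sup>2"
    by (rule sum_squares_bound)
  finally show "norm (x n \<bullet> y n) \<le> (cmod (x n))\<^sup>2 + (cmod (y n))\<^sup>2"
    by simp
qed

lift_definition scaleC_ell2 :: "complex \<Rightarrow> ell2 \<Rightarrow> ell2" (infixr \<open>*\<^sub>C\<close> 75)
  is "\<lambda>c x n. c * x n"
  by (simp add: norm_mult power_mult_distrib summable_mult)

instantiation ell2 :: real_inner
begin

lift_definition zero_ell2 :: ell2 is "\<lambda>_. 0" by simp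

lift_definition plus_ell2 :: "ell2 \<Rightarrow> ell2 \<Rightarrow> ell2" is "\<lambda>x y n. x n + y n"
  by (rule summable_ell2_add)

lift_definition uminus_ell2 :: "ell2 \<Rightarrow> ell2" is "\<lambda>x n. - x n" by simp

lift_definition minus_ell2 :: "ell2 \<Rightarrow> ell2 \<Rightarrow> ell2" is "\<lambda>x y n. x n - y n"
  using summable_ell2_add[where y = "\<lambda>n. - y n" for y] by simp

lift_definition scaleR_ell2 :: "real \<Rightarrow> ell2 \<Rightarrow> ell2" is "\<lambda>r x n. r *\<^sub>R x n"
  by (simp add: power_mult_distrib summable_mult)

lift_definition norm_ell2 :: "ell2 \<Rightarrow> real" is "\<lambda>x. sqrt (\<Sum>n. (cmod (x n))\<^sup>2)" .

text \<open>The class \<open>real_inner\<close> asks for a real inner product: the real part of the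
  Hermitian one. Complex linearity of maps is imposed separately below.\<close>

lift_definition inner_ell2 :: "ell2 \<Rightarrow> ell2 \<Rightarrow> real" is "\<lambda>x y. \<Sum>n. Re (x n * cnj (y n))" .

definition dist_ell2 :: "ell2 \<Rightarrow> ell2 \<Rightarrow> real" where
  "dist_ell2 x y = norm (x - y)"

definition sgn_ell2 :: "ell2 \<Rightarrow> ell2" where
  "sgn_ell2 x = inverse (norm x) *\<^sub>R x"

definition uniformity_ell2 :: "(ell2 \<times> ell2) filter" where
  "uniformity_ell2 = (INF e\<in>{0<..}. principal {(x, y). dist x y < e})"

definition open_ell2 :: "ell2 set \<Rightarrow> bool" where
  "open_ell2 U = (\<forall>x\<in>U. \<forall>\<^sub>F (x', y) in uniformity. x' = x \<longrightarrow> y \<in> U)"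

instance
proof
  have Re_inner: "Re (a * cnj b) = a \<bullet> b" for a b
    by (simp add: inner_complex_def)
  fix x y z :: ell2 and a b r :: real and U :: "ell2 set"
  show "x + y + z = x + (y + z)" by transfer (simp add: add.assoc)
  show "x + y = y + x" by transfer (simp add: add.commute)
  show "0 + x = x" by transfer simp
  show "- x + x = 0" by transfer simp
  show "x - y = x + - y" by transfer simp
  show "a *\<^sub>R (x + y) = a *\<^sub>R x + a *\<^sub>R y" by transfer (simp add: scaleR_add_right)
  show "(a + b) *\<^sub>R x = a *\<^sub>R x + b *\<^sub>R x" by transfer (simp add: scaleR_add_left)
  show "a *\<^sub>R b *\<^sub>R x = (a * b) *\<^sub>R x" by transfer simp
  show "1 *\<^sub>R x = x" by transfer simp
  show "sgn x = inverse (norm x) *\<^sub>R x" by (rule sgn_ell2_def)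
  show "dist x y = norm (x - y)" by (rule dist_ell2_def)
  show "(uniformity :: (ell2 \<times> ell2) filter) = (INF e\<in>{0<..}. principal {(x, y). dist x y < e})"
    by (rule uniformity_ell2_def)
  show "open U = (\<forall>x\<in>U. \<forall>\<^sub>F (x', y) in uniformity. x' = x \<longrightarrow> y \<in> U)"
    by (rule open_ell2_def)
  show "inner x y = inner y x" by transfer (simp add: mult.commute)
  show "inner (x + y) z = inner x z + inner y z"
    by transfer (simp only: Re_inner inner_add_left, intro suminf_add[symmetric] summable_ell2_inner)
  show "inner (r *\<^sub>R x) y = r * inner x y"
    by transfer (simp only: Re_inner inner_scaleR_left, intro suminf_mult summable_ell2_inner)
  show "0 \<le> inner x x"
    by transfer (simp only: Re_inner power2_norm_eq_inner[symmetric], simp add: suminf_nonneg)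
  show "inner x x = 0 \<longleftrightarrow> x = 0"
    by transfer (simp only: Re_inner power2_norm_eq_inner[symmetric], simp add: suminf_eq_zero_iff fun_eq_iff)
  show "norm x = sqrt (inner x x)"
    by transfer (simp only: Re_inner power2_norm_eq_inner[symmetric])
qed

end

text \<open>The type \<open>ell2 \<Rightarrow>\<^sub>L _\<close> consists of the real-linear bounded maps, with the operator norm.\<close>

definition clinear_operators :: "(ell2 \<Rightarrow>\<^sub>L ell2) set" where
  "clinear_operators = {T. \<forall>c x. blinfun_apply T (c *\<^sub>C x) = c *\<^sub>C blinfun_apply T x}"

definition dual_ell2 :: "(ell2 \<Rightarrow>\<^sub>L complex) set" where
  "dual_ell2 = {\<phi>. \<forall>c x. blinfun_apply \<phi> (c *\<^sub>C x) = c * blinfun_apply \<phi> x}"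

definition B1 :: "(ell2 \<Rightarrow>\<^sub>L ell2) set" where
  "B1 = {T \<in> clinear_operators. norm T \<le> 1}"

text \<open>The Banach space adjoint \<open>T\<^sup>*\<close>, acting on functionals.\<close>

definition adjoint_op :: "(ell2 \<Rightarrow>\<^sub>L ell2) \<Rightarrow> (ell2 \<Rightarrow>\<^sub>L complex) \<Rightarrow> (ell2 \<Rightarrow>\<^sub>L complex)" where
  "adjoint_op T \<phi> = \<phi> o\<^sub>L T"

text \<open>The coarsest topology on \<open>B1\<close> for which all \<open>T \<mapsto> T x\<close> and all \<open>T \<mapsto> T\<^sup>* \<phi>\<close>,
  for \<open>\<phi>\<close> in the dual, are norm continuous.\<close>

definition SOT_star :: "(ell2 \<Rightarrow>\<^sub>L ell2) topology" where
  "SOT_star = topology_generated_by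
     ({{T \<in> B1. blinfun_apply T x \<in> U} | x U. open U} \<union>
      {{T \<in> B1. adjoint_op T \<phi> \<in> V} | \<phi> V. \<phi> \<in> dual_ell2 \<and> open V})"

lemma topspace_SOT_star: "topspace SOT_star = B1"
proof -
  have "B1 = {T \<in> B1. blinfun_apply T 0 \<in> UNIV}" by simp
  then have "B1 \<in> {{T \<in> B1. blinfun_apply T x \<in> U} | x U. open U}" by blast
  then show ?thesis
    unfolding SOT_star_def topology_generated_by_topspace by blast
qed

lemma limitin_SOT_star:
  "limitin SOT_star f T F \<longleftrightarrow> T \<in> B1 \<and> (\<forall>\<^sub>F i in F. f i \<in> B1) \<and>
     (\<forall>x. ((\<lambda>i. blinfun_apply (f i) x) \<longlongrightarrow> blinfun_apply T x) F) \<and>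
     (\<forall>\<phi>\<in>dual_ell2. ((\<lambda>i. adjoint_op (f i) \<phi>) \<longlongrightarrow> adjoint_op T \<phi>) F)"
  (is "_ \<longleftrightarrow> ?R")
proof
  assume L: "limitin SOT_star f T F"
  have T: "T \<in> B1" using L by (simp add: limitin_def topspace_SOT_star)
  have ev: "\<forall>\<^sub>F i in F. f i \<in> S" if "openin SOT_star S" "T \<in> S" for S
    using L that by (simp add: limitin_def)
  have "\<forall>\<^sub>F i in F. f i \<in> B1"
    using ev[of B1] T openin_topspace[of SOT_star] by (simp add: topspace_SOT_star)
  moreover have "((\<lambda>i. blinfun_apply (f i) x) \<longlongrightarrow> blinfun_apply T x) F" for x
  proof (rule topological_tendstoI)
    fix U :: "ell2 set" assume "open U" "blinfun_apply T x \<in> U"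
    have "openin SOT_star {T \<in> B1. blinfun_apply T x \<in> U}"
      unfolding SOT_star_def using \<open>open U\<close> by (intro topology_generated_by_Basis) blast
    from ev[OF this] show "\<forall>\<^sub>F i in F. blinfun_apply (f i) x \<in> U"
      using T \<open>blinfun_apply T x \<in> U\<close> by (auto elim: eventually_mono)
  qed
  moreover have "((\<lambda>i. adjoint_op (f i) \<phi>) \<longlongrightarrow> adjoint_op T \<phi>) F" if "\<phi> \<in> dual_ell2" for \<phi>
  proof (rule topological_tendstoI)
    fix V :: "(ell2 \<Rightarrow>\<^sub>L complex) set" assume "open V" "adjoint_op T \<phi> \<in> V"
    have "openin SOT_star {T \<in> B1. adjoint_op T \<phi> \<in> V}"
      unfolding SOT_star_def using \<open>open V\<close> that by (intro topology_generated_by_Basis) blast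
    from ev[OF this] show "\<forall>\<^sub>F i in F. adjoint_op (f i) \<phi> \<in> V"
      using T \<open>adjoint_op T \<phi> \<in> V\<close> by (auto elim: eventually_mono)
  qed
  ultimately show ?R using T by blast
next
  assume R: ?R
  have "\<forall>\<^sub>F i in F. f i \<in> S" if "generate_topology_on
     ({{T \<in> B1. blinfun_apply T x \<in> U} | x U. open U} \<union>
      {{T \<in> B1. adjoint_op T \<phi> \<in> V} | \<phi> V. \<phi> \<in> dual_ell2 \<and> open V}) S" "T \<in> S" for S
    using that
  proof (induction rule: generate_topology_on.induct)
    case Empty
    then show ?case by simp
  next
    case (Int a b)
    then show ?case by (simp add: eventually_conj)
  next
    case (UN K)
    then obtain k where k: "k \<in> K" "T \<in> k" by blast
    from UN.IH[OF this] show ?case by (rule eventually_mono) (use k in blast)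
  next
    case (Basis s)
    have B: "\<forall>\<^sub>F i in F. f i \<in> B1" using R by blast
    from Basis(1) show ?case
    proof
      assume "s \<in> {{T \<in> B1. blinfun_apply T x \<in> U} | x U. open U}"
      then obtain x U where s: "s = {T \<in> B1. blinfun_apply T x \<in> U}" "open U" by blast
      have "\<forall>\<^sub>F i in F. blinfun_apply (f i) x \<in> U"
        using R Basis(2) s by (auto intro: topological_tendstoD)
      with B show ?thesis unfolding s(1) by eventually_elim simp
    next
      assume "s \<in> {{T \<in> B1. adjoint_op T \<phi> \<in> V} | \<phi> V. \<phi> \<in> dual_ell2 \<and> open V}"
      then obtain \<phi> V where s: "s = {T \<in> B1. adjoint_op T \<phi> \<in> V}" "\<phi> \<in> dual_ell2" "open V"
        by blast
      have "\<forall>\<^sub>F i in F. adjoint_op (f i) \<phi> \<in> V"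
        using R Basis(2) s by (auto intro: topological_tendstoD)
      with B show ?thesis unfolding s(1) by eventually_elim simp
    qed
  qed
  then show "limitin SOT_star f T F"
    using R unfolding limitin_def topspace_SOT_star
    by (auto simp: SOT_star_def openin_topology_generated_by_iff)
qed

definition comeager_in :: "'a topology \<Rightarrow> 'a set \<Rightarrow> bool" where
  "comeager_in X A \<longleftrightarrow>
     A \<subseteq> topspace X \<and> (\<exists>G. gdelta_in X G \<and> X closure_of G = topspace X \<and> G \<subseteq> A)"

definition typical_SOT_star :: "((ell2 \<Rightarrow>\<^sub>L ell2) \<Rightarrow> bool) \<Rightarrow> bool" where
  "typical_SOT_star P \<longleftrightarrow> comeager_in SOT_star {T \<in> B1. P T}"

definition compact_operator :: "(ell2 \<Rightarrow>\<^sub>L ell2) \<Rightarrow> bool" where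
  "compact_operator K \<longleftrightarrow>
     K \<in> clinear_operators \<and> compact (closure (blinfun_apply K ` cball 0 1))"

end

theory Submission
  imports Defs "HOL-Computational_Algebra.Fundamental_Theorem_Algebra"
begin

text \<open>If \<open>K \<noteq> 0\<close> is compact then some matrix entry \<open>K\<^sub>b\<^sub>a\<close> is non-zero while \<open>K e\<^sub>n \<rightarrow> 0\<close>. The
  contractions commuting with some \<open>K\<close> of norm at most \<open>k\<close> for which \<open>\<bar>K\<^sub>b\<^sub>a\<bar>\<close> is bounded below and
  the columns beyond \<open>M\<close> have small entries form a closed set, because such \<open>K\<close> are compact in the
  weak operator topology. By Baire's theorem it suffices that these countably many closed sets have
  dense complement. To approximate a contraction, compress it to the first \<open>N\<close> coordinates, shrink
  it slightly, repeat it as a block diagonal operator \<open>A\<close>, and add \<open>\<delta> S\<close>, where \<open>S\<close> is the shift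
  by \<open>N\<close>. Since \<open>A\<close> commutes with \<open>S\<close> and is annihilated by a polynomial, for small \<open>\<delta>\<close> everything
  commuting with \<open>A + \<delta> S\<close> commutes with \<open>S\<close>. But \<open>K S = S K\<close> makes the entries of \<open>K\<close> constant
  along the diagonals in steps of \<open>N\<close>, which excludes the \<open>K\<close> above.\<close>

section \<open>Coordinates and truncations in \<open>ell2\<close>\<close>

lemma summable_Rep_ell2: "summable (\<lambda>n. (cmod (Rep_ell2 x n))\<^sup>2)"
  using Rep_ell2[of x] by simp

lemma norm_ell2_power2: "(norm x)\<^sup>2 = (\<Sum>n. (cmod (Rep_ell2 x n))\<^sup>2)"
  unfolding norm_ell2.rep_eq by (simp add: suminf_nonneg summable_Rep_ell2)

lemma sum_le_norm_ell2_power2: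
  assumes "finite I"
  shows "(\<Sum>n\<in>I. (cmod (Rep_ell2 x n))\<^sup>2) \<le> (norm x)\<^sup>2"
  unfolding norm_ell2_power2 by (rule sum_le_suminf[OF summable_Rep_ell2 assms]) simp

lemma cmod_Rep_ell2_le_norm: "cmod (Rep_ell2 x n) \<le> norm x"
  by (rule power2_le_imp_le) (use sum_le_norm_ell2_power2[of "{n}" x] in simp_all)

lemma norm_ell2_power2_leI:
  assumes "\<And>N. (\<Sum>n<N. (cmod (Rep_ell2 x n))\<^sup>2) \<le> B"
  shows "(norm x)\<^sup>2 \<le> B"
  unfolding norm_ell2_power2 using assms by (rule suminf_le_const[OF summable_Rep_ell2])

text \<open>\<open>Abs_ell2\<close> is meaningful only on square summable sequences. Limits and
  block operators are defined by raw coordinates, and a uniform bound on partial sums yields both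
  membership and the norm estimate.\<close>

lemma bounded_partial_sums_ell2:
  assumes "\<And>N. (\<Sum>n<N. (cmod (f n))\<^sup>2) \<le> B"
  shows "summable (\<lambda>n. (cmod (f n))\<^sup>2)" and "Rep_ell2 (Abs_ell2 f) = f"
    and "(norm (Abs_ell2 f))\<^sup>2 \<le> B"
proof -
  show s: "summable (\<lambda>n. (cmod (f n))\<^sup>2)"
    by (rule bounded_imp_summable[where B = B])
      (simp_all only: lessThan_Suc_atMost[symmetric] assms zero_le_power2)
  then show R: "Rep_ell2 (Abs_ell2 f) = f"
    by (simp add: Abs_ell2_inverse)
  show "(norm (Abs_ell2 f))\<^sup>2 \<le> B"
    by (rule norm_ell2_power2_leI) (simp add: R assms)
qed

lemma ell2_eqI: "(\<And>n. Rep_ell2 x n = Rep_ell2 y n) \<Longrightarrow> x = y"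
  by (simp add: Rep_ell2_inject[symmetric] fun_eq_iff)

lemma Rep_ell2_sum: "Rep_ell2 (\<Sum>i\<in>I. f i) n = (\<Sum>i\<in>I. Rep_ell2 (f i) n)"
  by (induction I rule: infinite_finite_induct) (auto simp: zero_ell2.rep_eq plus_ell2.rep_eq)

lemmas Rep_ell2_simps = zero_ell2.rep_eq plus_ell2.rep_eq uminus_ell2.rep_eq minus_ell2.rep_eq
  scaleR_ell2.rep_eq scaleC_ell2.rep_eq Rep_ell2_sum

lemma norm_scaleC: "norm (c *\<^sub>C x) = cmod c * norm x" for x :: ell2
proof -
  have "(norm (c *\<^sub>C x))\<^sup>2 = (cmod c * norm x)\<^sup>2"
    unfolding power_mult_distrib norm_ell2_power2
    by (simp add: Rep_ell2_simps norm_mult power_mult_distrib suminf_mult summable_Rep_ell2)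
  then show ?thesis by (simp add: power2_eq_iff_nonneg)
qed

lemma bounded_linear_scaleC: "bounded_linear (\<lambda>x. c *\<^sub>C x)"
  by (rule bounded_linear_intro[where K = "cmod c"])
    (auto intro!: ell2_eqI simp: Rep_ell2_simps norm_scaleC algebra_simps)

lemma bounded_linear_Rep_ell2: "bounded_linear (\<lambda>x. Rep_ell2 x n)"
  by (rule bounded_linear_intro[where K = 1])
    (auto simp: Rep_ell2_simps cmod_Rep_ell2_le_norm algebra_simps)

lift_definition ebasis :: "nat \<Rightarrow> ell2" is "\<lambda>k n. if n = k then 1 else 0"
  by (rule summable_finite[where N = "{k}" for k]) auto

lift_definition trunc :: "nat \<Rightarrow> ell2 \<Rightarrow> ell2" is "\<lambda>N x n. if n < N then x n else 0"
  by (rule summable_finite[where N = "{..<N}" for N]) auto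

lemma norm_ebasis [simp]: "norm (ebasis k) = 1"
proof -
  have "(norm (ebasis k))\<^sup>2 = (\<Sum>n\<in>{k}. (cmod (Rep_ell2 (ebasis k) n))\<^sup>2)"
    unfolding norm_ell2_power2 by (rule suminf_finite) (auto simp: ebasis.rep_eq)
  then have "(norm (ebasis k))\<^sup>2 = 1\<^sup>2" by (simp add: ebasis.rep_eq)
  then show ?thesis by (rule power2_eq_imp_eq) auto
qed

lemma trunc_eq_sum: "trunc N x = (\<Sum>n<N. Rep_ell2 x n *\<^sub>C ebasis n)"
  by (rule ell2_eqI)
    (simp add: Rep_ell2_simps trunc.rep_eq ebasis.rep_eq if_distrib[of "(*) _"] cong: if_cong)

lemma norm_trunc_le: "norm (trunc N x) \<le> norm x"
proof (rule power2_le_imp_le)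
  show "(norm (trunc N x))\<^sup>2 \<le> (norm x)\<^sup>2"
    unfolding norm_ell2_power2
    by (rule suminf_le[OF _ summable_Rep_ell2 summable_Rep_ell2]) (simp add: trunc.rep_eq)
qed simp

lemma bounded_linear_trunc: "bounded_linear (trunc N)"
  by (rule bounded_linear_intro[where K = 1])
    (auto intro!: ell2_eqI simp: Rep_ell2_simps trunc.rep_eq norm_trunc_le)

text \<open>Pythagoras for the splitting into the first \<open>N\<close> coordinates and the
  tail.\<close>

lemma norm_diff_trunc:
  "(norm (x - trunc N x))\<^sup>2 = (norm x)\<^sup>2 - (\<Sum>n<N. (cmod (Rep_ell2 x n))\<^sup>2)"
proof -
  have "(norm (x - trunc N x))\<^sup>2
      = (\<Sum>n. (cmod (Rep_ell2 (x - trunc N x) (n + N)))\<^sup>2)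
        + (\<Sum>n<N. (cmod (Rep_ell2 (x - trunc N x) n))\<^sup>2)"
    unfolding norm_ell2_power2 by (rule suminf_split_initial_segment[OF summable_Rep_ell2])
  also have "\<dots> = (\<Sum>n. (cmod (Rep_ell2 x (n + N)))\<^sup>2)"
    by (simp add: Rep_ell2_simps trunc.rep_eq)
  finally show ?thesis
    using suminf_split_initial_segment[OF summable_Rep_ell2, of x N]
    unfolding norm_ell2_power2[of x] by linarith
qed

lemma trunc_tendsto: "(\<lambda>N. trunc N x) \<longlonglongrightarrow> x"
proof -
  have "(\<lambda>N. \<Sum>n<N. (cmod (Rep_ell2 x n))\<^sup>2) \<longlonglongrightarrow> (norm x)\<^sup>2"
    unfolding norm_ell2_power2 by (rule summable_LIMSEQ[OF summable_Rep_ell2])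
  then have "(\<lambda>N. (norm x)\<^sup>2 - (\<Sum>n<N. (cmod (Rep_ell2 x n))\<^sup>2)) \<longlonglongrightarrow> (norm x)\<^sup>2 - (norm x)\<^sup>2"
    by (intro tendsto_intros)
  then have "(\<lambda>N. sqrt ((norm (x - trunc N x))\<^sup>2)) \<longlonglongrightarrow> sqrt 0"
    unfolding norm_diff_trunc by (intro tendsto_real_sqrt) simp
  then show ?thesis
    by (simp add: tendsto_norm_zero_iff LIM_zero_iff norm_minus_commute[of x])
qed

section \<open>Completeness of the sequence space\<close>

text \<open>Completeness gives the limits in \<open>strong_operator_limit\<close> and makes the
  target space of \<open>SOT_embed\<close> completely metrizable.\<close>

instance ell2 :: banach
proof
  fix X :: "nat \<Rightarrow> ell2" assume X: "Cauchy X"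
  have "Cauchy (\<lambda>k. Rep_ell2 (X k) n)" for n
    by (rule bounded_linear.Cauchy[OF bounded_linear_Rep_ell2 X])
  then obtain y where y: "\<And>n. (\<lambda>k. Rep_ell2 (X k) n) \<longlonglongrightarrow> y n"
    unfolding Cauchy_convergent_iff convergent_def by metis
  \<comment> \<open>A Fatou argument: the bound on finite sums survives the coordinatewise limit in
    \<open>m\<close>. It serves first with bound \<open>1\<close>, to obtain a vector, and then with
    arbitrarily small bounds, to obtain convergence.\<close>
  have sum_diff: "(\<Sum>n<N. (cmod (Rep_ell2 (X k) n - y n))\<^sup>2) \<le> e\<^sup>2"
    if "\<And>m. m \<ge> M \<Longrightarrow> norm (X k - X m) \<le> e" for k M e N
  proof (rule tendsto_upperbound)
    show "(\<lambda>m. \<Sum>n<N. (cmod (Rep_ell2 (X k) n - Rep_ell2 (X m) n))\<^sup>2)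
        \<longlonglongrightarrow> (\<Sum>n<N. (cmod (Rep_ell2 (X k) n - y n))\<^sup>2)"
      by (intro tendsto_intros y)
    have "(\<Sum>n<N. (cmod (Rep_ell2 (X k) n - Rep_ell2 (X m) n))\<^sup>2) \<le> e\<^sup>2" if "m \<ge> M" for m
    proof -
      have "(\<Sum>n<N. (cmod (Rep_ell2 (X k - X m) n))\<^sup>2) \<le> (norm (X k - X m))\<^sup>2"
        by (rule sum_le_norm_ell2_power2) simp
      also have "\<dots> \<le> e\<^sup>2"
        using \<open>\<And>m. m \<ge> M \<Longrightarrow> norm (X k - X m) \<le> e\<close>[OF that] by (intro power_mono) auto
      finally show ?thesis by (simp add: Rep_ell2_simps)
    qed
    then show "\<forall>\<^sub>F m in sequentially. (\<Sum>n<N. (cmod (Rep_ell2 (X k) n - Rep_ell2 (X m) n))\<^sup>2) \<le> e\<^sup>2"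
      unfolding eventually_sequentially by blast
  qed simp
  obtain M where M: "\<And>k m. k \<ge> M \<Longrightarrow> m \<ge> M \<Longrightarrow> norm (X k - X m) < 1"
    using X unfolding Cauchy_iff by (meson zero_less_one)
  have bd: "(\<Sum>n<N. (cmod (Rep_ell2 (X M) n - y n))\<^sup>2) \<le> 1\<^sup>2" for N
    by (rule sum_diff[where M = M]) (use M in \<open>auto intro: less_imp_le\<close>)
  \<comment> \<open>Square summability is available for the difference from \<open>X M\<close>, not
    directly for \<open>y\<close>, so the limit is recovered as \<open>X M - d\<close>.\<close>
  define d where "d = Abs_ell2 (\<lambda>n. Rep_ell2 (X M) n - y n)"
  have Rd: "Rep_ell2 d = (\<lambda>n. Rep_ell2 (X M) n - y n)"
    unfolding d_def by (rule bounded_partial_sums_ell2(2)[OF bd])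
  define z where "z = X M - d"
  have Rz: "Rep_ell2 z n = y n" for n
    by (simp add: z_def Rep_ell2_simps Rd)
  have "X \<longlonglongrightarrow> z"
  proof (rule LIMSEQ_I)
    fix r :: real assume r: "r > 0"
    then obtain M' where M': "\<And>k m. k \<ge> M' \<Longrightarrow> m \<ge> M' \<Longrightarrow> norm (X k - X m) < r / 2"
      using X unfolding Cauchy_iff by (meson half_gt_zero)
    have "norm (X k - z) < r" if "k \<ge> M'" for k
    proof -
      have "(norm (X k - z))\<^sup>2 \<le> (r / 2)\<^sup>2"
        by (rule norm_ell2_power2_leI, simp only: Rep_ell2_simps Rz, rule sum_diff[where M = M'])
          (use M' that in \<open>auto intro: less_imp_le\<close>)
      then have "norm (X k - z) \<le> r / 2"
        by (rule power2_le_imp_le) (use r in simp)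
      then show ?thesis using r by simp
    qed
    then show "\<exists>no. \<forall>n\<ge>no. norm (X n - z) < r" by blast
  qed
  then show "convergent X" by (auto simp: convergent_def)
qed


section \<open>Bounded operators on \<open>ell2\<close>\<close>

definition coord :: "nat \<Rightarrow> ell2 \<Rightarrow>\<^sub>L complex" where
  "coord n = Blinfun (\<lambda>x. Rep_ell2 x n)"

definition Trunc :: "nat \<Rightarrow> ell2 \<Rightarrow>\<^sub>L ell2" where
  "Trunc N = Blinfun (trunc N)"

text \<open>The bounded operators form only a real vector space here, so a complex scalar enters as
  an operator, as in \<open>A - cscale l\<close>.\<close>

definition cscale :: "complex \<Rightarrow> ell2 \<Rightarrow>\<^sub>L ell2" where
  "cscale c = Blinfun (\<lambda>x. c *\<^sub>C x)"

lemma coord_apply [simp]: "blinfun_apply (coord n) x = Rep_ell2 x n"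
  unfolding coord_def by (simp add: bounded_linear_Blinfun_apply bounded_linear_Rep_ell2)

lemma Trunc_apply [simp]: "blinfun_apply (Trunc N) x = trunc N x"
  unfolding Trunc_def by (simp add: bounded_linear_Blinfun_apply bounded_linear_trunc)

lemma cscale_apply [simp]: "blinfun_apply (cscale c) x = c *\<^sub>C x"
  unfolding cscale_def by (simp add: bounded_linear_Blinfun_apply bounded_linear_scaleC)

lemma norm_cscale_compose: "norm (cscale c o\<^sub>L T) = cmod c * norm T"
proof (rule antisym)
  show "norm (cscale c o\<^sub>L T) \<le> cmod c * norm T"
    by (rule norm_blinfun_bound)
      (auto simp: norm_scaleC mult.assoc intro!: mult_left_mono norm_blinfun)
  show "cmod c * norm T \<le> norm (cscale c o\<^sub>L T)"
  proof (cases "c = 0")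
    case False
    have "norm T \<le> norm (cscale c o\<^sub>L T) / cmod c"
    proof (rule norm_blinfun_bound)
      fix x
      have "cmod c * norm (T x) \<le> norm (cscale c o\<^sub>L T) * norm x"
        using norm_blinfun[of "cscale c o\<^sub>L T" x] by (simp add: norm_scaleC)
      then show "norm (T x) \<le> norm (cscale c o\<^sub>L T) / cmod c * norm x"
        using False by (simp add: field_simps)
    qed (use False in simp)
    then show ?thesis using False by (simp add: field_simps)
  qed simp
qed

lemma clinear_operators_scaleC: "T \<in> clinear_operators \<Longrightarrow> T (c *\<^sub>C x) = c *\<^sub>C T x"
  by (simp add: clinear_operators_def)

lemma B1_clinear: "T \<in> B1 \<Longrightarrow> T \<in> clinear_operators" and B1_norm: "T \<in> B1 \<Longrightarrow> norm T \<le> 1"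
  by (auto simp: B1_def)

section \<open>Complex linear functionals and their values on the basis\<close>

lemma coord_in_dual: "coord n \<in> dual_ell2"
  by (simp add: dual_ell2_def Rep_ell2_simps)

lemma dual_compose: "\<phi> \<in> dual_ell2 \<Longrightarrow> T \<in> clinear_operators \<Longrightarrow> \<phi> o\<^sub>L T \<in> dual_ell2"
  by (simp add: dual_ell2_def clinear_operators_def)

lemma dual_apply_trunc:
  assumes "\<phi> \<in> dual_ell2"
  shows "\<phi> (trunc N x) = (\<Sum>n<N. Rep_ell2 x n * \<phi> (ebasis n))"
  using assms by (simp add: trunc_eq_sum blinfun.sum_right dual_ell2_def)

text \<open>Half of the Riesz representation: on the vector \<open>a\<close> of conjugates of its
  first \<open>N\<close> values, \<phi> takes the value \<open>(norm a)\<^sup>2\<close>, and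
  dividing by \<open>norm a\<close> bounds \<open>norm a\<close> by
  \<open>norm \<phi>\<close>.\<close>

lemma dual_sum_le:
  assumes "\<phi> \<in> dual_ell2"
  shows "(\<Sum>n<N. (cmod (\<phi> (ebasis n)))\<^sup>2) \<le> (norm \<phi>)\<^sup>2"
proof -
  define s where "s = (\<Sum>n<N. (cmod (\<phi> (ebasis n)))\<^sup>2)"
  define a where "a = Abs_ell2 (\<lambda>n. if n < N then cnj (\<phi> (ebasis n)) else 0)"
  have "summable (\<lambda>n. (cmod (if n < N then cnj (\<phi> (ebasis n)) else 0))\<^sup>2)"
    by (rule summable_finite[where N = "{..<N}"]) auto
  then have R: "Rep_ell2 a = (\<lambda>n. if n < N then cnj (\<phi> (ebasis n)) else 0)"
    unfolding a_def by (simp add: Abs_ell2_inverse)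
  have s0: "0 \<le> s" unfolding s_def by (rule sum_nonneg) simp
  have "(norm a)\<^sup>2 = (\<Sum>n<N. (cmod (Rep_ell2 a n))\<^sup>2)"
    unfolding norm_ell2_power2 by (rule suminf_finite) (auto simp: R)
  then have na: "(norm a)\<^sup>2 = s" by (simp add: R s_def)
  have "trunc N a = a" by (rule ell2_eqI) (simp add: trunc.rep_eq R)
  then have "\<phi> a = (\<Sum>n<N. Rep_ell2 a n * \<phi> (ebasis n))"
    using dual_apply_trunc[OF assms, of N a] by simp
  also have "\<dots> = complex_of_real s"
    by (simp add: R s_def mult.commute complex_mult_cnj cmod_power2)
  finally have "s \<le> norm \<phi> * norm a"
    using norm_blinfun[of \<phi> a] s0 by simp
  then have "(norm a)\<^sup>2 \<le> norm \<phi> * norm a" by (simp add: na)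
  then have "norm a \<le> norm \<phi>"
    by (cases "norm a = 0") (auto simp: power2_eq_square)
  then show ?thesis using na unfolding s_def by (metis norm_ge_zero power_mono)
qed

lemma dual_summable:
  assumes "\<phi> \<in> dual_ell2"
  shows "summable (\<lambda>n. (cmod (\<phi> (ebasis n)))\<^sup>2)"
  by (rule bounded_partial_sums_ell2(1)[OF dual_sum_le[OF assms]])

lemma dual_ebasis_tendsto_0:
  assumes "\<phi> \<in> dual_ell2"
  shows "(\<lambda>n. \<phi> (ebasis n)) \<longlonglongrightarrow> 0"
proof -
  have "(\<lambda>n. sqrt ((cmod (\<phi> (ebasis n)))\<^sup>2)) \<longlonglongrightarrow> sqrt 0"
    by (intro tendsto_real_sqrt summable_LIMSEQ_zero dual_summable[OF assms])
  then show ?thesis by (simp add: tendsto_norm_zero_iff)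
qed

text \<open>By Cauchy-Schwarz the part of \<phi> beyond coordinate \<open>N\<close> has norm at most
  the square summable tail of its values on the basis. Functionals of finitely many coordinates are
  thus norm dense in the dual, which later reduces statements about all \<phi> to the functionals
  \<open>coord n\<close>.\<close>

lemma dual_compose_Trunc_tendsto:
  assumes "\<phi> \<in> dual_ell2"
  shows "(\<lambda>N. \<phi> o\<^sub>L Trunc N) \<longlonglongrightarrow> \<phi>"
proof -
  define g where "g n = (cmod (\<phi> (ebasis n)))\<^sup>2" for n
  have g: "summable g" unfolding g_def by (rule dual_summable[OF assms])
  define r where "r N = sqrt (suminf g - sum g {..<N})" for N
  have "(\<lambda>N. suminf g - sum g {..<N}) \<longlonglongrightarrow> suminf g - suminf g"
    by (intro tendsto_intros summable_LIMSEQ g)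
  then have r0: "r \<longlonglongrightarrow> 0"
    unfolding r_def using tendsto_real_sqrt by fastforce
  have "norm (\<phi> - (\<phi> o\<^sub>L Trunc N)) \<le> r N" for N
  proof (rule norm_blinfun_bound)
    have "sum g {..<N} \<le> suminf g"
      by (rule sum_le_suminf[OF g]) (auto simp: g_def)
    then show "0 \<le> r N" by (simp add: r_def)
    fix y
    \<comment> \<open>On truncations \<phi> is an explicit finite sum; the estimate for
      \<open>y\<close> itself follows by letting \<open>M\<close> tend to infinity.\<close>
    have "cmod (\<phi> (trunc M y) - \<phi> (trunc N y)) \<le> r N * norm y" if "M \<ge> N" for M
    proof -
      have "{..<M} = {..<N} \<union> {N..<M}" using that by auto
      then have "\<phi> (trunc M y) - \<phi> (trunc N y) = (\<Sum>n\<in>{N..<M}. Rep_ell2 y n * \<phi> (ebasis n))"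
        and gM: "sum g {..<M} = sum g {..<N} + sum g {N..<M}"
        unfolding dual_apply_trunc[OF assms] by (auto simp: sum.union_disjoint ivl_disj_int)
      then have "cmod (\<phi> (trunc M y) - \<phi> (trunc N y))
          \<le> (\<Sum>n\<in>{N..<M}. \<bar>cmod (\<phi> (ebasis n))\<bar> * \<bar>cmod (Rep_ell2 y n)\<bar>)"
        by (simp add: sum_norm_le norm_mult mult.commute)
      also have "\<dots> \<le> L2_set (\<lambda>n. cmod (\<phi> (ebasis n))) {N..<M} * L2_set (\<lambda>n. cmod (Rep_ell2 y n)) {N..<M}"
        by (rule L2_set_mult_ineq)
      also have "\<dots> \<le> r N * norm y"
      proof (rule mult_mono)
        have "sum g {..<M} \<le> suminf g"
          by (rule sum_le_suminf[OF g]) (auto simp: g_def)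
        then show "L2_set (\<lambda>n. cmod (\<phi> (ebasis n))) {N..<M} \<le> r N"
          using gM unfolding L2_set_def r_def g_def by simp
        show "L2_set (\<lambda>n. cmod (Rep_ell2 y n)) {N..<M} \<le> norm y"
          unfolding L2_set_def
          by (rule real_le_lsqrt) (auto simp: sum_nonneg sum_le_norm_ell2_power2)
        show "0 \<le> r N" by fact
      qed (simp add: L2_set_nonneg)
      finally show ?thesis .
    qed
    then have "\<forall>\<^sub>F M in sequentially. cmod (\<phi> (trunc M y) - \<phi> (trunc N y)) \<le> r N * norm y"
      unfolding eventually_sequentially by blast
    moreover have "(\<lambda>M. cmod (\<phi> (trunc M y) - \<phi> (trunc N y))) \<longlonglongrightarrow> cmod (\<phi> y - \<phi> (trunc N y))"
      by (intro tendsto_intros trunc_tendsto)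
    ultimately show "norm ((\<phi> - (\<phi> o\<^sub>L Trunc N)) y) \<le> r N * norm y"
      using tendsto_upperbound[of "\<lambda>M. cmod (\<phi> (trunc M y) - \<phi> (trunc N y))" _ sequentially]
      by (simp add: blinfun.diff_left)
  qed
  then have "(\<lambda>N. (\<phi> o\<^sub>L Trunc N) - \<phi>) \<longlonglongrightarrow> 0"
    by (intro Lim_null_comparison[OF _ r0]) (simp add: norm_minus_commute)
  then show ?thesis by (simp only: LIM_zero_iff)
qed

section \<open>Convergence of operators tested on the basis\<close>

text \<open>Split \<open>x\<close> into a finite combination of basis vectors, where convergence is
  assumed, and a tail that uniformly bounded operators keep small. The maps are only real linear,
  hence the test on all complex multiples of basis vectors.\<close>

lemma tendsto_blinfun_apply_basis:
  fixes f :: "'i \<Rightarrow> ell2 \<Rightarrow>\<^sub>L 'b::real_normed_vector" and g :: "ell2 \<Rightarrow>\<^sub>L 'b"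
  assumes bd: "\<forall>\<^sub>F i in F. norm (f i) \<le> C"
    and lim: "\<And>n c. ((\<lambda>i. f i (c *\<^sub>C ebasis n)) \<longlongrightarrow> g (c *\<^sub>C ebasis n)) F"
  shows "((\<lambda>i. f i x) \<longlongrightarrow> g x) F"
proof (rule tendstoI)
  fix e :: real assume e: "e > 0"
  have "(\<lambda>N. (\<bar>C\<bar> + norm g) * norm (x - trunc N x)) \<longlonglongrightarrow> (\<bar>C\<bar> + norm g) * norm (x - x)"
    by (intro tendsto_intros trunc_tendsto)
  then have "\<forall>\<^sub>F N in sequentially. (\<bar>C\<bar> + norm g) * norm (x - trunc N x) < e / 2"
    by (rule order_tendstoD) (use e in simp)
  then obtain N where N: "(\<bar>C\<bar> + norm g) * norm (x - trunc N x) < e / 2"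
    by (auto dest: eventually_happens)
  define t where "t = trunc N x"
  have "((\<lambda>i. f i t) \<longlongrightarrow> g t) F"
    unfolding t_def trunc_eq_sum blinfun.sum_right by (intro tendsto_intros lim)
  then have "\<forall>\<^sub>F i in F. dist (f i t) (g t) < e / 2"
    by (rule tendstoD) (use e in simp)
  with bd show "\<forall>\<^sub>F i in F. dist (f i x) (g x) < e"
  proof eventually_elim
    case (elim i)
    have eq: "f i x - g x = f i (x - t) + (f i t - g t) - g (x - t)"
      by (simp add: blinfun.diff_right)
    have "norm (f i x - g x) \<le> norm (f i (x - t)) + norm (f i t - g t) + norm (g (x - t))"
      unfolding eq by (rule order_trans[OF norm_triangle_ineq4 add_right_mono[OF norm_triangle_ineq]])
    moreover have "norm (f i (x - t)) \<le> \<bar>C\<bar> * norm (x - t)"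
      by (rule order_trans[OF norm_blinfun mult_right_mono])
        (use elim in \<open>simp_all add: abs_if\<close>)
    moreover have "norm (g (x - t)) \<le> norm g * norm (x - t)" by (rule norm_blinfun)
    ultimately show ?case using elim N unfolding dist_norm t_def[symmetric] distrib_right
      by linarith
  qed
qed

text \<open>The same splitting as a Cauchy criterion, for use when no limit operator is known
  yet.\<close>

lemma convergent_blinfun_apply_basis:
  fixes f :: "nat \<Rightarrow> ell2 \<Rightarrow>\<^sub>L 'b::banach"
  assumes bd: "\<And>k. norm (f k) \<le> C"
    and conv: "\<And>n c. convergent (\<lambda>k. f k (c *\<^sub>C ebasis n))"
  shows "convergent (\<lambda>k. f k x)"
proof -
  have "Cauchy (\<lambda>k. f k x)"
  proof (rule CauchyI)
    fix e :: real assume e: "e > 0"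
    have C0: "C \<ge> 0" by (rule order_trans[OF norm_ge_zero bd[of 0]])
    have "(\<lambda>N. 2 * C * norm (x - trunc N x)) \<longlonglongrightarrow> 2 * C * norm (x - x)"
      by (intro tendsto_intros trunc_tendsto)
    then have "\<forall>\<^sub>F N in sequentially. 2 * C * norm (x - trunc N x) < e / 2"
      by (rule order_tendstoD) (use e in simp)
    then obtain N where N: "2 * C * norm (x - trunc N x) < e / 2"
      unfolding eventually_sequentially by blast
    define t where "t = trunc N x"
    have "convergent (\<lambda>k. f k t)"
      unfolding t_def trunc_eq_sum blinfun.sum_right by (intro convergent_sum conv)
    then have "Cauchy (\<lambda>k. f k t)" by (simp add: convergent_Cauchy)
    then obtain M where M: "\<And>m n. m \<ge> M \<Longrightarrow> n \<ge> M \<Longrightarrow> norm (f m t - f n t) < e / 2"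
      using e unfolding Cauchy_iff by (meson half_gt_zero)
    have "norm (f m x - f n x) < e" if "m \<ge> M" "n \<ge> M" for m n
    proof -
      have eq: "f m x - f n x = f m (x - t) + (f m t - f n t) - f n (x - t)"
        by (simp add: blinfun.diff_right)
      have "norm (f m x - f n x) \<le> norm (f m (x - t)) + norm (f m t - f n t) + norm (f n (x - t))"
        unfolding eq by (rule order_trans[OF norm_triangle_ineq4 add_right_mono[OF norm_triangle_ineq]])
      moreover have "norm (f k (x - t)) \<le> C * norm (x - t)" for k
        by (rule order_trans[OF norm_blinfun mult_right_mono]) (use bd in auto)
      from this[of m] this[of n] have "norm (f m (x - t)) + norm (f n (x - t)) \<le> 2 * C * norm (x - t)"
        by simp
      ultimately show ?thesis using M[OF that] N unfolding t_def[symmetric] by linarith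
    qed
    then show "\<exists>M. \<forall>m\<ge>M. \<forall>n\<ge>M. norm (f m x - f n x) < e" by blast
  qed
  then show ?thesis by (rule Cauchy_convergent)
qed

text \<open>The limit is built coordinate by coordinate. For fixed \<open>x\<close> the finite sums
  of squares stay below \<open>(C * norm x)\<^sup>2\<close> in the limit, so the limiting
  coordinates form a vector; linearity follows from uniqueness of limits.\<close>

lemma weak_operator_limit:
  fixes K :: "nat \<Rightarrow> ell2 \<Rightarrow>\<^sub>L ell2"
  assumes K: "\<And>k. K k \<in> clinear_operators" and bd: "\<And>k. norm (K k) \<le> C"
    and conv: "\<And>i n. convergent (\<lambda>k. Rep_ell2 (K k (ebasis n)) i)"
  obtains L where "L \<in> clinear_operators" "norm L \<le> C"
    "\<And>x i. (\<lambda>k. Rep_ell2 (K k x) i) \<longlonglongrightarrow> Rep_ell2 (blinfun_apply L x) i"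
proof -
  have C0: "C \<ge> 0" by (rule order_trans[OF norm_ge_zero bd[of 0]])
  have "convergent (\<lambda>k. (coord i o\<^sub>L K k) x)" for x i
  proof (rule convergent_blinfun_apply_basis)
    show "norm (coord i o\<^sub>L K k) \<le> C" for k
    proof (rule norm_blinfun_bound[OF C0])
      fix x
      have "cmod (Rep_ell2 (K k x) i) \<le> norm (K k x)" by (rule cmod_Rep_ell2_le_norm)
      also have "\<dots> \<le> C * norm x"
        by (rule order_trans[OF norm_blinfun mult_right_mono]) (use bd in auto)
      finally show "norm ((coord i o\<^sub>L K k) x) \<le> C * norm x" by simp
    qed
    show "convergent (\<lambda>k. (coord i o\<^sub>L K k) (c *\<^sub>C ebasis n))" for n c
      using conv[of n i]
      by (simp add: clinear_operators_scaleC[OF K] Rep_ell2_simps convergent_mult convergent_const)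
  qed
  then have z': "convergent (\<lambda>k. Rep_ell2 (K k x) i)" for x i
    by simp
  define z where "z x i = lim (\<lambda>k. Rep_ell2 (K k x) i)" for x i
  have z: "(\<lambda>k. Rep_ell2 (K k x) i) \<longlonglongrightarrow> z x i" for x i
    unfolding z_def using z' convergent_LIMSEQ_iff by blast
  have sum_le: "(\<Sum>i<N. (cmod (z x i))\<^sup>2) \<le> (C * norm x)\<^sup>2" for x N
  proof (rule tendsto_upperbound)
    show "(\<lambda>k. \<Sum>i<N. (cmod (Rep_ell2 (K k x) i))\<^sup>2) \<longlonglongrightarrow> (\<Sum>i<N. (cmod (z x i))\<^sup>2)"
      by (intro tendsto_intros z)
    have "(\<Sum>i<N. (cmod (Rep_ell2 (K k x) i))\<^sup>2) \<le> (C * norm x)\<^sup>2" for k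
    proof -
      have "(\<Sum>i<N. (cmod (Rep_ell2 (K k x) i))\<^sup>2) \<le> (norm (K k x))\<^sup>2"
        by (rule sum_le_norm_ell2_power2) simp
      also have "norm (K k x) \<le> C * norm x"
        by (rule order_trans[OF norm_blinfun mult_right_mono]) (use bd in auto)
      then have "(norm (K k x))\<^sup>2 \<le> (C * norm x)\<^sup>2" by (intro power_mono) auto
      finally show ?thesis .
    qed
    then show "\<forall>\<^sub>F k in sequentially. (\<Sum>i<N. (cmod (Rep_ell2 (K k x) i))\<^sup>2) \<le> (C * norm x)\<^sup>2"
      by simp
  qed simp
  define Lf where "Lf x = Abs_ell2 (z x)" for x
  have R: "Rep_ell2 (Lf x) = z x" for x
    unfolding Lf_def by (rule bounded_partial_sums_ell2(2)[OF sum_le])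
  have nL: "norm (Lf x) \<le> norm x * C" for x
    by (rule power2_le_imp_le)
      (use bounded_partial_sums_ell2(3)[OF sum_le, of x] C0 in \<open>simp_all add: Lf_def mult.commute\<close>)
  have bl: "bounded_linear Lf"
  proof (rule bounded_linear_intro[where K = C])
    show "Lf (x + y) = Lf x + Lf y" for x y
    proof (rule ell2_eqI)
      fix i
      have "(\<lambda>k. Rep_ell2 (K k (x + y)) i) \<longlonglongrightarrow> z x i + z y i"
        unfolding blinfun.add_right Rep_ell2_simps by (intro tendsto_intros z)
      then show "Rep_ell2 (Lf (x + y)) i = Rep_ell2 (Lf x + Lf y) i"
        unfolding Rep_ell2_simps R by (rule LIMSEQ_unique[OF z])
    qed
    show "Lf (r *\<^sub>R x) = r *\<^sub>R Lf x" for r x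
    proof (rule ell2_eqI)
      fix i
      have "(\<lambda>k. Rep_ell2 (K k (r *\<^sub>R x)) i) \<longlonglongrightarrow> r *\<^sub>R z x i"
        unfolding blinfun.scaleR_right Rep_ell2_simps by (intro tendsto_intros z)
      then show "Rep_ell2 (Lf (r *\<^sub>R x)) i = Rep_ell2 (r *\<^sub>R Lf x) i"
        unfolding Rep_ell2_simps R by (rule LIMSEQ_unique[OF z])
    qed
  qed (rule nL)
  define L where "L = Blinfun Lf"
  have La: "blinfun_apply L x = Lf x" for x
    unfolding L_def by (simp add: bounded_linear_Blinfun_apply bl)
  show thesis
  proof
    show "(\<lambda>k. Rep_ell2 (K k x) i) \<longlonglongrightarrow> Rep_ell2 (blinfun_apply L x) i" for x i
      unfolding La R by (rule z)
    show "norm L \<le> C"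
      by (rule norm_blinfun_bound[OF C0]) (use nL in \<open>simp add: La mult.commute\<close>)
    have "Lf (c *\<^sub>C x) = c *\<^sub>C Lf x" for c x
    proof (rule ell2_eqI)
      fix i
      have "(\<lambda>k. Rep_ell2 (K k (c *\<^sub>C x)) i) \<longlonglongrightarrow> c * z x i"
        unfolding clinear_operators_scaleC[OF K] Rep_ell2_simps by (intro tendsto_intros z)
      then show "Rep_ell2 (Lf (c *\<^sub>C x)) i = Rep_ell2 (c *\<^sub>C Lf x) i"
        unfolding Rep_ell2_simps R by (rule LIMSEQ_unique[OF z])
    qed
    then show "L \<in> clinear_operators" by (simp add: clinear_operators_def La)
  qed
qed


section \<open>Complete metrizability of \<open>SOT_star\<close>\<close>

text \<open>Convergence of adjoints need only be tested on coordinate functionals: \<phi> is norm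
  close to \<open>\<phi> o\<^sub>L Trunc N\<close>, which is a finite combination of them, and the
  operators are uniformly bounded.\<close>

lemma tendsto_compose_dual:
  fixes f :: "'i \<Rightarrow> ell2 \<Rightarrow>\<^sub>L ell2"
  assumes bd: "\<forall>\<^sub>F i in F. norm (f i) \<le> C" and \<phi>: "\<phi> \<in> dual_ell2"
    and lim: "\<And>n. ((\<lambda>i. coord n o\<^sub>L f i) \<longlongrightarrow> coord n o\<^sub>L T) F"
  shows "((\<lambda>i. \<phi> o\<^sub>L f i) \<longlongrightarrow> \<phi> o\<^sub>L T) F"
proof (rule tendstoI)
  fix e :: real assume e: "e > 0"
  have "(\<lambda>N. norm (\<phi> - (\<phi> o\<^sub>L Trunc N)) * (\<bar>C\<bar> + norm T)) \<longlonglongrightarrow> norm (\<phi> - \<phi>) * (\<bar>C\<bar> + norm T)"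
    by (intro tendsto_intros dual_compose_Trunc_tendsto \<phi>)
  then have "\<forall>\<^sub>F N in sequentially. norm (\<phi> - (\<phi> o\<^sub>L Trunc N)) * (\<bar>C\<bar> + norm T) < e / 2"
    by (rule order_tendstoD) (use e in simp)
  then obtain N where N: "norm (\<phi> - (\<phi> o\<^sub>L Trunc N)) * (\<bar>C\<bar> + norm T) < e / 2"
    unfolding eventually_sequentially by blast
  define \<psi> where "\<psi> = \<phi> o\<^sub>L Trunc N"
  have \<psi>: "\<psi> o\<^sub>L S = (\<Sum>n<N. blinfun_mult_right (\<phi> (ebasis n)) o\<^sub>L (coord n o\<^sub>L S))" for S
    by (rule blinfun_eqI)
      (simp add: \<psi>_def dual_apply_trunc[OF \<phi>] blinfun.sum_left mult.commute)
  have "((\<lambda>i. \<psi> o\<^sub>L f i) \<longlongrightarrow> \<psi> o\<^sub>L T) F"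
    unfolding \<psi>
    by (intro tendsto_sum bounded_bilinear.tendsto[OF bounded_bilinear_blinfun_compose] tendsto_const lim)
  then have "\<forall>\<^sub>F i in F. dist (\<psi> o\<^sub>L f i) (\<psi> o\<^sub>L T) < e / 2"
    by (rule tendstoD) (use e in simp)
  with bd show "\<forall>\<^sub>F i in F. dist (\<phi> o\<^sub>L f i) (\<phi> o\<^sub>L T) < e"
  proof eventually_elim
    case (elim i)
    have eq: "(\<phi> o\<^sub>L f i) - (\<phi> o\<^sub>L T)
        = ((\<phi> - \<psi>) o\<^sub>L f i) + ((\<psi> o\<^sub>L f i) - (\<psi> o\<^sub>L T)) - ((\<phi> - \<psi>) o\<^sub>L T)"
      by (rule blinfun_eqI) (simp add: blinfun.diff_left blinfun.add_left)
    have "norm ((\<phi> o\<^sub>L f i) - (\<phi> o\<^sub>L T))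
        \<le> norm ((\<phi> - \<psi>) o\<^sub>L f i) + norm ((\<psi> o\<^sub>L f i) - (\<psi> o\<^sub>L T)) + norm ((\<phi> - \<psi>) o\<^sub>L T)"
      unfolding eq by (rule order_trans[OF norm_triangle_ineq4 add_right_mono[OF norm_triangle_ineq]])
    moreover have "norm ((\<phi> - \<psi>) o\<^sub>L f i) \<le> norm (\<phi> - \<psi>) * \<bar>C\<bar>"
      by (rule order_trans[OF norm_blinfun_compose mult_left_mono])
        (use elim in \<open>simp_all add: abs_if\<close>)
    moreover have "norm ((\<phi> - \<psi>) o\<^sub>L T) \<le> norm (\<phi> - \<psi>) * norm T" by (rule norm_blinfun_compose)
    ultimately show ?case using elim N
      unfolding dist_norm \<psi>_def[symmetric] distrib_left by linarith
  qed
qed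

text \<open>On the unit ball countably many tests, the columns and the rows of the matrix, decide
  convergence. This is the source of metrizability.\<close>

lemma limitin_SOT_starI:
  fixes f :: "'i \<Rightarrow> ell2 \<Rightarrow>\<^sub>L ell2"
  assumes T: "T \<in> B1" and f: "\<forall>\<^sub>F i in F. f i \<in> B1"
    and lim: "\<And>n. ((\<lambda>i. f i (ebasis n)) \<longlongrightarrow> T (ebasis n)) F"
    and lim': "\<And>n. ((\<lambda>i. coord n o\<^sub>L f i) \<longlongrightarrow> coord n o\<^sub>L T) F"
  shows "limitin SOT_star f T F"
  unfolding limitin_SOT_star
proof (intro conjI allI ballI T f)
  have bd: "\<forall>\<^sub>F i in F. norm (f i) \<le> 1"
    using f by eventually_elim (simp add: B1_norm)
  show "((\<lambda>i. adjoint_op (f i) \<phi>) \<longlongrightarrow> adjoint_op T \<phi>) F" if "\<phi> \<in> dual_ell2" for \<phi>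
    unfolding adjoint_op_def by (rule tendsto_compose_dual[OF bd that lim'])
  show "((\<lambda>i. f i x) \<longlongrightarrow> T x) F" for x
  proof (rule tendsto_blinfun_apply_basis[OF bd])
    fix n c
    have "((\<lambda>i. c *\<^sub>C f i (ebasis n)) \<longlongrightarrow> c *\<^sub>C T (ebasis n)) F"
      by (rule bounded_linear.tendsto[OF bounded_linear_scaleC lim])
    moreover have "\<forall>\<^sub>F i in F. c *\<^sub>C f i (ebasis n) = f i (c *\<^sub>C ebasis n)"
      using f by eventually_elim (simp add: clinear_operators_scaleC B1_clinear)
    ultimately show "((\<lambda>i. f i (c *\<^sub>C ebasis n)) \<longlongrightarrow> T (c *\<^sub>C ebasis n)) F"
      unfolding clinear_operators_scaleC[OF B1_clinear[OF T]] by (rule Lim_transform_eventually)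
  qed
qed

text \<open>The weak limit supplies a contraction, the Cauchy criterion supplies norm limits of the
  vectors \<open>f k x\<close>, and comparing coordinates identifies the two.\<close>

lemma strong_operator_limit:
  fixes f :: "nat \<Rightarrow> ell2 \<Rightarrow>\<^sub>L ell2"
  assumes f: "\<And>k. f k \<in> B1" and conv: "\<And>n. convergent (\<lambda>k. f k (ebasis n))"
  obtains T where "T \<in> B1" "\<And>x. (\<lambda>k. f k x) \<longlonglongrightarrow> blinfun_apply T x"
proof -
  note f' = B1_clinear[OF f] B1_norm[OF f]
  have "convergent (\<lambda>k. Rep_ell2 (f k (ebasis n)) i)" for i n
    by (rule convergentI[OF bounded_linear.tendsto[OF bounded_linear_Rep_ell2 conv[unfolded convergent_LIMSEQ_iff]]])
  from weak_operator_limit[OF f' this] obtain L where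
    L: "L \<in> clinear_operators" "norm L \<le> 1"
      "\<And>x i. (\<lambda>k. Rep_ell2 (f k x) i) \<longlonglongrightarrow> Rep_ell2 (blinfun_apply L x) i"
    by blast
  have "(\<lambda>k. f k x) \<longlonglongrightarrow> L x" for x
  proof -
    have "convergent (\<lambda>k. f k (c *\<^sub>C ebasis n))" for c n
      unfolding clinear_operators_scaleC[OF f'(1)]
      by (rule convergentI[OF bounded_linear.tendsto[OF bounded_linear_scaleC conv[unfolded convergent_LIMSEQ_iff]]])
    from convergent_blinfun_apply_basis[OF f'(2) this] obtain y where y: "(\<lambda>k. f k x) \<longlonglongrightarrow> y"
      unfolding convergent_def by blast
    have "Rep_ell2 y i = Rep_ell2 (L x) i" for i
      by (rule LIMSEQ_unique[OF bounded_linear.tendsto[OF bounded_linear_Rep_ell2 y] L(3)])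
    then have "y = L x" by (rule ell2_eqI)
    with y show ?thesis by simp
  qed
  with L(1,2) show thesis by (intro that[of L]) (auto simp: B1_def)
qed

section \<open>Embedding of the unit ball into a countable product\<close>

lemma tendsto_fun_iff:
  fixes l :: "'a \<Rightarrow> 'b::topological_space"
  shows "(f \<longlongrightarrow> l) F \<longleftrightarrow> (\<forall>n. ((\<lambda>i. f i n) \<longlongrightarrow> l n) F)"
  using limitin_componentwise[of "\<lambda>_. euclidean :: 'b topology" UNIV f l F]
  by (simp add: euclidean_product_topology)

lemma atin_within_euclidean: "atin_within euclidean a S = (at a within S)"
  unfolding filter_eq_iff eventually_atin_within eventually_at_topological by auto

text \<open>The columns and rows of the matrix of \<open>T\<close>, exactly the data tested in
  \<open>limitin_SOT_starI\<close>.\<close>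

definition SOT_embed :: "(ell2 \<Rightarrow>\<^sub>L ell2) \<Rightarrow> nat \<Rightarrow> ell2 \<times> (ell2 \<Rightarrow>\<^sub>L complex)" where
  "SOT_embed T n = (T (ebasis n), coord n o\<^sub>L T)"

lemma SOT_embed_inj: "SOT_embed S = SOT_embed T \<Longrightarrow> S = T"
proof (rule blinfun_eqI, rule ell2_eqI)
  fix x n
  assume "SOT_embed S = SOT_embed T"
  then have "coord n o\<^sub>L S = coord n o\<^sub>L T"
    unfolding SOT_embed_def fun_eq_iff by auto
  then have "(coord n o\<^sub>L S) x = (coord n o\<^sub>L T) x" by simp
  then show "Rep_ell2 (S x) n = Rep_ell2 (T x) n" by simp
qed

text \<open>Convergent columns produce a contraction by \<open>strong_operator_limit\<close>. Its
  rows are the limits of the given rows, because norm limits of functionals are also pointwise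
  limits.\<close>

lemma closed_SOT_embed_image: "closed (SOT_embed ` B1)"
  unfolding closed_sequential_limits
proof (intro allI impI, elim conjE)
  fix g h assume "\<forall>k. g k \<in> SOT_embed ` B1" and lim: "g \<longlonglongrightarrow> h"
  then have "\<forall>k. \<exists>T. T \<in> B1 \<and> g k = SOT_embed T" by blast
  then obtain f where "\<forall>k. f k \<in> B1 \<and> g k = SOT_embed (f k)"
    by (rule choice[THEN exE])
  then have f: "f k \<in> B1" and g: "g k = SOT_embed (f k)" for k by auto
  have lim_n: "(\<lambda>k. g k n) \<longlonglongrightarrow> h n" for n
    using lim by (simp add: tendsto_fun_iff)
  have 1: "(\<lambda>k. f k (ebasis n)) \<longlonglongrightarrow> fst (h n)" and 2: "(\<lambda>k. coord n o\<^sub>L f k) \<longlonglongrightarrow> snd (h n)" for n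
    using tendsto_fst[OF lim_n] tendsto_snd[OF lim_n] by (simp_all add: g SOT_embed_def)
  obtain T where T: "T \<in> B1" "\<And>x. (\<lambda>k. f k x) \<longlonglongrightarrow> blinfun_apply T x"
    using strong_operator_limit[OF f convergentI[OF 1]] by blast
  have "SOT_embed T = h"
  proof
    fix n
    have "T (ebasis n) = fst (h n)"
      by (rule LIMSEQ_unique[OF T(2) 1])
    moreover have "coord n o\<^sub>L T = snd (h n)"
    proof (rule blinfun_eqI)
      fix x
      have "(\<lambda>k. (coord n o\<^sub>L f k) x) \<longlonglongrightarrow> snd (h n) x"
        by (intro tendsto_intros 2)
      moreover have "(\<lambda>k. Rep_ell2 (f k x) n) \<longlonglongrightarrow> Rep_ell2 (T x) n"
        by (rule bounded_linear.tendsto[OF bounded_linear_Rep_ell2 T(2)])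
      ultimately show "(coord n o\<^sub>L T) x = snd (h n) x"
        by (simp add: LIMSEQ_unique)
    qed
    ultimately show "SOT_embed T n = h n" by (simp add: SOT_embed_def prod_eq_iff)
  qed
  with T(1) show "h \<in> SOT_embed ` B1" by blast
qed

text \<open>\<open>SOT_embed\<close> is a homeomorphism onto a closed subset of a complete space.
  Complete metrizability is used twice later: for testing closedness on sequences and for Baire's
  theorem.\<close>

lemma completely_metrizable_SOT_star: "completely_metrizable_space SOT_star"
proof -
  let ?Y = "top_of_set (SOT_embed ` B1)"
  have inv: "inv_into B1 SOT_embed (SOT_embed T) = T" if "T \<in> B1" for T
    by (rule inv_into_f_f[OF _ that]) (auto intro: inj_onI SOT_embed_inj)
  have "homeomorphic_maps SOT_star ?Y SOT_embed (inv_into B1 SOT_embed)"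
    unfolding homeomorphic_maps_def
  proof (intro conjI ballI)
    show "inv_into B1 SOT_embed (SOT_embed x) = x" if "x \<in> topspace SOT_star" for x
      using that by (simp add: topspace_SOT_star inv)
    show "SOT_embed (inv_into B1 SOT_embed y) = y" if "y \<in> topspace ?Y" for y
      using that by (auto simp: inv)
    have "limitin euclidean SOT_embed (SOT_embed T) (atin SOT_star T)" if T: "T \<in> topspace SOT_star" for T
    proof -
      have "limitin SOT_star (\<lambda>S. S) T (atin SOT_star T)"
        using limitin_continuous_map[OF continuous_map_id T refl] by (simp add: id_def)
      then have lim: "((\<lambda>S. blinfun_apply S x) \<longlongrightarrow> T x) (atin SOT_star T)"
        "\<phi> \<in> dual_ell2 \<Longrightarrow> ((\<lambda>S. adjoint_op S \<phi>) \<longlongrightarrow> adjoint_op T \<phi>) (atin SOT_star T)" for x \<phi>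
        unfolding limitin_SOT_star by auto
      show ?thesis
        unfolding limitin_canonical_iff SOT_embed_def tendsto_fun_iff
        using lim(1) lim(2)[OF coord_in_dual] by (auto intro!: tendsto_Pair simp: adjoint_op_def)
    qed
    then have "continuous_map SOT_star euclidean SOT_embed"
      unfolding continuous_map_atin by blast
    then show "continuous_map SOT_star ?Y SOT_embed"
      by (auto simp: continuous_map_in_subtopology topspace_SOT_star)
    \<comment> \<open>The inverse is continuous because columns and rows of the operator are read
      off continuously from the point \<open>h\<close> of the image.\<close>
    have "limitin SOT_star (inv_into B1 SOT_embed) T (at (SOT_embed T) within SOT_embed ` B1)"
      if T: "T \<in> B1" for T
    proof -
      let ?F = "at (SOT_embed T) within SOT_embed ` B1"
      have mem: "\<forall>\<^sub>F h in ?F. h \<in> SOT_embed ` B1"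
        by (simp add: eventually_at_filter)
      have ev: "\<forall>\<^sub>F h in ?F. inv_into B1 SOT_embed h \<in> B1 \<and> h = SOT_embed (inv_into B1 SOT_embed h)"
        using mem by eventually_elim (auto simp: inv)
      have "((\<lambda>h. h) \<longlongrightarrow> SOT_embed T) ?F" by (rule tendsto_ident_at)
      then have lim: "((\<lambda>h. h n) \<longlongrightarrow> SOT_embed T n) ?F" for n
        by (simp add: tendsto_fun_iff)
      show ?thesis
      proof (rule limitin_SOT_starI[OF T])
        show "\<forall>\<^sub>F h in ?F. inv_into B1 SOT_embed h \<in> B1"
          using ev by eventually_elim simp
        fix n
        have "\<forall>\<^sub>F h in ?F. h n = SOT_embed (inv_into B1 SOT_embed h) n"
          using ev by eventually_elim (elim conjE fun_cong)
        then have 0: "\<forall>\<^sub>F h in ?F. h n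
            = (inv_into B1 SOT_embed h (ebasis n), coord n o\<^sub>L inv_into B1 SOT_embed h)"
          by (rule eventually_mono) (simp only: SOT_embed_def[of "inv_into _ _ _"])
        have 1: "\<forall>\<^sub>F h in ?F. fst (h n) = inv_into B1 SOT_embed h (ebasis n)"
          using 0 by (rule eventually_mono) (simp only: fst_conv)
        have 2: "\<forall>\<^sub>F h in ?F. snd (h n) = coord n o\<^sub>L inv_into B1 SOT_embed h"
          using 0 by (rule eventually_mono) (simp only: snd_conv)
        show "((\<lambda>h. inv_into B1 SOT_embed h (ebasis n)) \<longlongrightarrow> T (ebasis n)) ?F"
          using Lim_transform_eventually[OF tendsto_fst[OF lim] 1] by (simp only: SOT_embed_def[of T] fst_conv)
        show "((\<lambda>h. coord n o\<^sub>L inv_into B1 SOT_embed h) \<longlongrightarrow> coord n o\<^sub>L T) ?F"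
          using Lim_transform_eventually[OF tendsto_snd[OF lim] 2] by (simp only: SOT_embed_def[of T] snd_conv)
      qed
    qed
    then show "continuous_map ?Y SOT_star (inv_into B1 SOT_embed)"
      unfolding continuous_map_atin by (auto simp: atin_subtopology_within atin_within_euclidean inv)
  qed
  then have hom: "SOT_star homeomorphic_space ?Y"
    using homeomorphic_space_def by blast
  have "completely_metrizable_space ?Y"
    by (rule completely_metrizable_space_closedin[OF completely_metrizable_space_euclidean])
      (simp only: closed_closedin[symmetric] closed_SOT_embed_image)
  then show ?thesis by (simp only: homeomorphic_completely_metrizable_space[OF hom])
qed


section \<open>Operators with one large and eventually small matrix entries\<close>

text \<open>All conditions are non-strict inequalities on the norm and on single entries, so they
  survive weak limits; compactness of \<open>K\<close> would not. The gap between \<open>1\<close>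
  and \<open>1 / 2\<close> is what contradicts entries that are constant along a diagonal.\<close>

definition pinched :: "nat \<Rightarrow> nat \<Rightarrow> nat \<Rightarrow> nat \<Rightarrow> (ell2 \<Rightarrow>\<^sub>L ell2) set" where
  "pinched a b k M = {K \<in> clinear_operators. norm K \<le> real k
     \<and> 1 \<le> real k * cmod (Rep_ell2 (K (ebasis a)) b)
     \<and> (\<forall>n\<ge>M. \<forall>i. real k * cmod (Rep_ell2 (K (ebasis n)) i) \<le> 1 / 2)}"

text \<open>Matrices with entries bounded by \<open>k\<close> form a compact set by Tychonoff. The
  countable product is metrizable, so a subsequence converges entrywise, and
  \<open>weak_operator_limit\<close> turns the limiting matrix into an operator.\<close>

lemma pinched_weak_limit:
  assumes K: "\<And>j. K j \<in> pinched a b k M"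
  obtains r L where "strict_mono (r :: nat \<Rightarrow> nat)" "L \<in> pinched a b k M"
    "\<And>x i. (\<lambda>j. Rep_ell2 (K (r j) x) i) \<longlonglongrightarrow> Rep_ell2 (blinfun_apply L x) i"
proof -
  \<comment> \<open>In the index pair \<open>p\<close> the row comes first and the column
    second.\<close>
  define E where "E j p = Rep_ell2 (K j (ebasis (snd p))) (fst p)" for j and p :: "nat \<times> nat"
  have K': "K j \<in> clinear_operators" "norm (K j) \<le> real k" for j
    using K[of j] by (auto simp: pinched_def)
  define C :: "(nat \<times> nat \<Rightarrow> complex) set" where "C = PiE UNIV (\<lambda>_. cball 0 (real k))"
  have "compactin (product_topology (\<lambda>_. euclidean) UNIV) C"
    unfolding C_def compactin_PiE by (simp add: compact_cball)
  then have "compact C"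
    by (simp add: euclidean_product_topology)
  then have "seq_compact C"
    by (simp add: compact_eq_seq_compact_metric)
  moreover have "E j \<in> C" for j
  proof -
    have "cmod (E j p) \<le> real k" for p
      using order_trans[OF cmod_Rep_ell2_le_norm[of _ "fst p"] norm_blinfun[of "K j" "ebasis (snd p)"]]
        K'(2)[of j] by (simp add: E_def)
    then show ?thesis by (auto simp: C_def PiE_def)
  qed
  ultimately obtain e r where r: "strict_mono (r :: nat \<Rightarrow> nat)" and e: "(E \<circ> r) \<longlonglongrightarrow> e"
    unfolding seq_compact_def by blast
  have lim: "(\<lambda>j. E (r j) p) \<longlonglongrightarrow> e p" for p
    using e unfolding tendsto_fun_iff o_def by blast
  have "convergent (\<lambda>j. Rep_ell2 (K (r j) (ebasis n)) i)" for i n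
    using lim[of "(i, n)"] unfolding E_def fst_conv snd_conv by (rule convergentI)
  from weak_operator_limit[of "\<lambda>j. K (r j)", OF K' this]
  obtain L where L: "L \<in> clinear_operators" "norm L \<le> real k"
    "\<And>x i. (\<lambda>j. Rep_ell2 (K (r j) x) i) \<longlonglongrightarrow> Rep_ell2 (blinfun_apply L x) i"
    by blast
  have limk: "(\<lambda>j. real k * cmod (Rep_ell2 (K (r j) x) i)) \<longlonglongrightarrow> real k * cmod (Rep_ell2 (L x) i)" for x i
    by (intro tendsto_intros L(3))
  have "1 \<le> real k * cmod (Rep_ell2 (L (ebasis a)) b)"
    by (rule tendsto_lowerbound[OF limk]) (use K in \<open>simp_all add: pinched_def\<close>)
  moreover have "real k * cmod (Rep_ell2 (L (ebasis n)) i) \<le> 1 / 2" if "n \<ge> M" for n i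
    by (rule tendsto_upperbound[OF limk]) (use K that in \<open>simp_all add: pinched_def\<close>)
  ultimately have "L \<in> pinched a b k M"
    using L(1,2) by (simp add: pinched_def)
  with r L(3) show thesis by (intro that[of r L])
qed

text \<open>For bounded sequences coordinatewise convergence is weak convergence, again by
  approximating \<phi> in norm by functionals of finitely many coordinates.\<close>

lemma dual_tendsto_weak:
  fixes y :: "nat \<Rightarrow> ell2"
  assumes \<phi>: "\<phi> \<in> dual_ell2" and bd: "\<And>j. norm (y j) \<le> C"
    and lim: "\<And>i. (\<lambda>j. Rep_ell2 (y j) i) \<longlonglongrightarrow> Rep_ell2 z i"
  shows "(\<lambda>j. \<phi> (y j)) \<longlonglongrightarrow> \<phi> z"
proof (rule tendstoI)
  fix e :: real assume e: "e > 0"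
  have "(\<lambda>N. norm (\<phi> - (\<phi> o\<^sub>L Trunc N)) * (C + norm z)) \<longlonglongrightarrow> norm (\<phi> - \<phi>) * (C + norm z)"
    by (intro tendsto_intros dual_compose_Trunc_tendsto \<phi>)
  then have "\<forall>\<^sub>F N in sequentially. norm (\<phi> - (\<phi> o\<^sub>L Trunc N)) * (C + norm z) < e / 2"
    by (rule order_tendstoD) (use e in simp)
  then obtain N where N: "norm (\<phi> - (\<phi> o\<^sub>L Trunc N)) * (C + norm z) < e / 2"
    unfolding eventually_sequentially by blast
  define \<psi> where "\<psi> = \<phi> o\<^sub>L Trunc N"
  have "(\<lambda>j. \<psi> (y j)) \<longlonglongrightarrow> \<psi> z"
    unfolding \<psi>_def by (simp add: dual_apply_trunc[OF \<phi>]) (intro tendsto_intros lim)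
  then have "\<forall>\<^sub>F j in sequentially. dist (\<psi> (y j)) (\<psi> z) < e / 2"
    by (rule tendstoD) (use e in simp)
  then show "\<forall>\<^sub>F j in sequentially. dist (\<phi> (y j)) (\<phi> z) < e"
  proof eventually_elim
    case (elim j)
    have eq: "\<phi> (y j) - \<phi> z = (\<phi> - \<psi>) (y j) + (\<psi> (y j) - \<psi> z) - (\<phi> - \<psi>) z"
      by (simp add: blinfun.diff_left)
    have "norm (\<phi> (y j) - \<phi> z) \<le> norm ((\<phi> - \<psi>) (y j)) + norm (\<psi> (y j) - \<psi> z) + norm ((\<phi> - \<psi>) z)"
      unfolding eq by (rule order_trans[OF norm_triangle_ineq4 add_right_mono[OF norm_triangle_ineq]])
    moreover have "norm ((\<phi> - \<psi>) (y j)) \<le> norm (\<phi> - \<psi>) * C"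
      by (rule order_trans[OF norm_blinfun mult_left_mono]) (simp_all add: bd)
    moreover have "norm ((\<phi> - \<psi>) z) \<le> norm (\<phi> - \<psi>) * norm z" by (rule norm_blinfun)
    ultimately show ?case using elim N
      unfolding dist_norm \<psi>_def[symmetric] distrib_left by linarith
  qed
qed

text \<open>By metrizability sequences suffice. If \<open>\<sigma> j\<close> tends to
  \<open>l\<close> and commutes with \<open>K j\<close>, a subsequence of the \<open>K j\<close>
  tends weakly to some \<open>L\<close>, and both products converge weakly: one through convergence
  of the adjoints, the other through strong convergence.\<close>

lemma closedin_commuting_pinched:
  "closedin SOT_star {T \<in> B1. \<exists>K \<in> pinched a b k M. T o\<^sub>L K = K o\<^sub>L T}" (is "closedin _ ?B")
proof -
  obtain X d where "Metric_space X d" and X: "SOT_star = Metric_space.mtopology X d"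
    using completely_metrizable_SOT_star unfolding completely_metrizable_space_def by blast
  interpret Metric_space X d by fact
  have "l \<in> ?B" if \<sigma>: "range \<sigma> \<subseteq> ?B" and l: "limitin SOT_star \<sigma> l sequentially" for \<sigma> l
  proof -
    have "\<forall>j. \<exists>K. K \<in> pinched a b k M \<and> \<sigma> j o\<^sub>L K = K o\<^sub>L \<sigma> j" using \<sigma> by blast
    then obtain K where "\<forall>j. K j \<in> pinched a b k M \<and> \<sigma> j o\<^sub>L K j = K j o\<^sub>L \<sigma> j"
      by (rule choice[THEN exE])
    then have K: "K j \<in> pinched a b k M" and comm: "\<sigma> j o\<^sub>L K j = K j o\<^sub>L \<sigma> j" for j by auto
    have nK: "norm (K j) \<le> real k" for j using K[of j] by (simp add: pinched_def)
    obtain r L where r: "strict_mono (r :: nat \<Rightarrow> nat)" and L: "L \<in> pinched a b k M"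
      and lim: "\<And>x i. (\<lambda>j. Rep_ell2 (K (r j) x) i) \<longlonglongrightarrow> Rep_ell2 (blinfun_apply L x) i"
      by (rule pinched_weak_limit[of K, OF K]) (rule that)
    have lB: "l \<in> B1" and \<sigma>x: "(\<lambda>j. \<sigma> j x) \<longlonglongrightarrow> l x"
      and \<sigma>\<phi>: "\<phi> \<in> dual_ell2 \<Longrightarrow> (\<lambda>j. \<phi> o\<^sub>L \<sigma> j) \<longlonglongrightarrow> (\<phi> o\<^sub>L l)" for x \<phi>
      using l unfolding limitin_SOT_star adjoint_op_def by blast+
    have bdK: "norm (K j x) \<le> real k * norm x" for j x
      by (rule order_trans[OF norm_blinfun mult_right_mono]) (simp_all add: nK)
    have "l o\<^sub>L L = L o\<^sub>L l"
    proof (rule blinfun_eqI, rule ell2_eqI)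
      fix x :: ell2 and i :: nat
      have cl: "coord i o\<^sub>L l \<in> dual_ell2"
        by (rule dual_compose[OF coord_in_dual B1_clinear[OF lB]])
      \<comment> \<open>The vectors \<open>K (r j) x\<close> converge only weakly, but they are
        bounded and the functionals applied to them converge in norm.\<close>
      have "(\<lambda>j. (coord i o\<^sub>L \<sigma> (r j)) - (coord i o\<^sub>L l)) \<longlonglongrightarrow> 0"
        by (rule LIM_zero[OF LIMSEQ_subseq_LIMSEQ[OF \<sigma>\<phi>[OF coord_in_dual] r, unfolded o_def]])
      then have "(\<lambda>j. norm ((coord i o\<^sub>L \<sigma> (r j)) - (coord i o\<^sub>L l)) * (real k * norm x)) \<longlonglongrightarrow> 0"
        by (intro tendsto_mult_left_zero tendsto_norm_zero)
      then have "(\<lambda>j. ((coord i o\<^sub>L \<sigma> (r j)) - (coord i o\<^sub>L l)) (K (r j) x)) \<longlonglongrightarrow> 0"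
        by (rule Lim_null_comparison[rotated])
          (rule always_eventually, rule allI,
            rule order_trans[OF norm_blinfun mult_left_mono[OF bdK norm_ge_zero]])
      moreover have "(\<lambda>j. (coord i o\<^sub>L l) (K (r j) x)) \<longlonglongrightarrow> (coord i o\<^sub>L l) (L x)"
        by (rule dual_tendsto_weak[OF cl bdK lim])
      ultimately have "(\<lambda>j. ((coord i o\<^sub>L \<sigma> (r j)) - (coord i o\<^sub>L l)) (K (r j) x)
          + (coord i o\<^sub>L l) (K (r j) x)) \<longlonglongrightarrow> 0 + (coord i o\<^sub>L l) (L x)"
        by (rule tendsto_add)
      then have 1: "(\<lambda>j. Rep_ell2 (\<sigma> (r j) (K (r j) x)) i) \<longlonglongrightarrow> Rep_ell2 (l (L x)) i"
        by (simp add: blinfun.diff_left)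
      \<comment> \<open>In the other order the vectors converge in norm, and the operators
        \<open>K (r j)\<close> are uniformly bounded.\<close>
      have "(\<lambda>j. K (r j) (\<sigma> (r j) x - l x)) \<longlonglongrightarrow> 0"
      proof (rule Lim_null_comparison)
        show "\<forall>\<^sub>F j in sequentially. norm (K (r j) (\<sigma> (r j) x - l x)) \<le> real k * norm (\<sigma> (r j) x - l x)"
          by (simp add: bdK)
        have "(\<lambda>j. real k * norm (\<sigma> (r j) x - l x)) \<longlonglongrightarrow> real k * norm (l x - l x)"
          by (intro tendsto_mult_left tendsto_norm tendsto_diff tendsto_const
              LIMSEQ_subseq_LIMSEQ[OF \<sigma>x r, unfolded o_def])
        then show "(\<lambda>j. real k * norm (\<sigma> (r j) x - l x)) \<longlonglongrightarrow> 0" by simp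
      qed
      from tendsto_add[OF bounded_linear.tendsto[OF bounded_linear_Rep_ell2[of i] this] lim[of "l x" i]]
      have 2: "(\<lambda>j. Rep_ell2 (K (r j) (\<sigma> (r j) x)) i) \<longlonglongrightarrow> Rep_ell2 (L (l x)) i"
        by (simp add: blinfun.diff_right Rep_ell2_simps)
      have "Rep_ell2 (\<sigma> (r j) (K (r j) x)) i = Rep_ell2 (K (r j) (\<sigma> (r j) x)) i" for j
        using arg_cong[OF comm[of "r j"], of "\<lambda>T. Rep_ell2 (T x) i"] by simp
      with 1 have "(\<lambda>j. Rep_ell2 (K (r j) (\<sigma> (r j) x)) i) \<longlonglongrightarrow> Rep_ell2 (l (L x)) i"
        by (simp only:)
      from LIMSEQ_unique[OF this 2]
      show "Rep_ell2 ((l o\<^sub>L L) x) i = Rep_ell2 ((L o\<^sub>L l) x) i" by simp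
    qed
    with lB L show ?thesis by blast
  qed
  moreover have "?B \<subseteq> X"
    using topspace_SOT_star unfolding X topspace_mtopology by blast
  ultimately show ?thesis
    unfolding X metric_closedin_iff_sequentially_closed by blast
qed

section \<open>Compact operators on the basis vectors\<close>

lemma clinear_eq_0_on_basis:
  assumes T: "T \<in> clinear_operators" and 0: "\<And>n. T (ebasis n) = 0"
  shows "T = 0"
proof (rule blinfun_eqI)
  fix x
  have c0: "c *\<^sub>C 0 = (0 :: ell2)" for c
    by (rule ell2_eqI) (simp add: Rep_ell2_simps)
  have "T (trunc N x) = 0" for N
    by (simp add: trunc_eq_sum blinfun.sum_right clinear_operators_scaleC[OF T] 0 c0)
  moreover have "(\<lambda>N. T (trunc N x)) \<longlonglongrightarrow> T x"
    by (intro tendsto_intros trunc_tendsto)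
  ultimately show "T x = blinfun_apply 0 x"
    by (simp add: LIMSEQ_const_iff)
qed

text \<open>The basis is weakly null, so the images tend to 0 in every coordinate. A subsequence
  bounded away from 0 would by compactness have a norm limit that is both zero and non-zero.\<close>

lemma compact_operator_ebasis_tendsto_0:
  assumes "compact_operator K"
  shows "(\<lambda>n. K (ebasis n)) \<longlonglongrightarrow> 0"
proof (rule ccontr)
  assume "\<not> ?thesis"
  then obtain e where e: "e > 0" "\<And>N. \<exists>n\<ge>N. e \<le> norm (K (ebasis n))"
    unfolding LIMSEQ_iff by (auto simp: not_less)
  then have "infinite {n. e \<le> norm (K (ebasis n))}"
    by (auto simp: infinite_nat_iff_unbounded_le)
  then obtain r where r: "strict_mono (r :: nat \<Rightarrow> nat)" "\<And>j. e \<le> norm (K (ebasis (r j)))"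
    using infinite_enumerate by blast
  have "seq_compact (closure (blinfun_apply K ` cball 0 1))"
    using assms by (simp add: compact_operator_def compact_eq_seq_compact_metric)
  moreover have "K (ebasis (r j)) \<in> closure (blinfun_apply K ` cball 0 1)" for j
    by (rule subsetD[OF closure_subset]) simp
  ultimately obtain l s where s: "strict_mono (s :: nat \<Rightarrow> nat)"
    and l: "((\<lambda>j. K (ebasis (r j))) \<circ> s) \<longlonglongrightarrow> l"
    by (blast elim: seq_compactE[of _ "\<lambda>j. K (ebasis (r j))"])
  have "Rep_ell2 l i = 0" for i
  proof -
    have "coord i o\<^sub>L K \<in> dual_ell2"
      using assms by (intro dual_compose coord_in_dual) (simp add: compact_operator_def)
    from dual_ebasis_tendsto_0[OF this]
    have "(\<lambda>n. Rep_ell2 (K (ebasis n)) i) \<longlonglongrightarrow> 0" by simp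
    from LIMSEQ_subseq_LIMSEQ[OF this strict_mono_o[OF r(1) s]]
    have "(\<lambda>j. Rep_ell2 (K (ebasis (r (s j)))) i) \<longlonglongrightarrow> 0" by (simp add: o_def)
    moreover have "(\<lambda>j. Rep_ell2 (K (ebasis (r (s j)))) i) \<longlonglongrightarrow> Rep_ell2 l i"
      using bounded_linear.tendsto[OF bounded_linear_Rep_ell2 l] by (simp add: o_def)
    ultimately show ?thesis by (rule LIMSEQ_unique[symmetric])
  qed
  then have "l = 0" by (intro ell2_eqI) (simp add: Rep_ell2_simps)
  moreover have "e \<le> norm l"
    by (rule tendsto_lowerbound[OF tendsto_norm[OF l]]) (simp_all add: r(2))
  ultimately show False using e(1) by simp
qed

lemma compact_operator_pinched:
  assumes K: "compact_operator K" and "K \<noteq> 0"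
  obtains a b k M where "K \<in> pinched a b k M"
proof -
  have cl: "K \<in> clinear_operators" using K by (simp add: compact_operator_def)
  obtain a where "K (ebasis a) \<noteq> 0" using clinear_eq_0_on_basis[OF cl] \<open>K \<noteq> 0\<close> by blast
  then obtain b where "Rep_ell2 (K (ebasis a)) b \<noteq> 0"
    using ell2_eqI[of "K (ebasis a)" 0] by (auto simp: Rep_ell2_simps)
  then have c: "0 < cmod (Rep_ell2 (K (ebasis a)) b)" by simp
  obtain k1 :: nat where k1: "norm K \<le> real k1" using real_arch_simple by blast
  obtain k2 :: nat where k2: "1 / cmod (Rep_ell2 (K (ebasis a)) b) \<le> real k2"
    using real_arch_simple by blast
  \<comment> \<open>Large enough to dominate both \<open>norm K\<close> and the reciprocal of the
    chosen entry; \<open>Suc\<close> makes \<open>k\<close> visibly positive, so that the threshold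
    \<open>1 / (2 * real k)\<close> is positive.\<close>
  define k where "k = max k1 (Suc k2)"
  have "real k2 \<le> real k" and "0 < real k" by (simp_all add: k_def)
  have 1: "1 \<le> real k * cmod (Rep_ell2 (K (ebasis a)) b)"
  proof -
    have "1 \<le> real k2 * cmod (Rep_ell2 (K (ebasis a)) b)"
      using k2 c by (simp add: divide_le_eq)
    also have "\<dots> \<le> real k * cmod (Rep_ell2 (K (ebasis a)) b)"
      by (rule mult_right_mono[OF \<open>real k2 \<le> real k\<close>]) simp
    finally show ?thesis .
  qed
  have "\<forall>\<^sub>F n in sequentially. norm (K (ebasis n)) < 1 / (2 * real k)"
    using tendsto_norm[OF compact_operator_ebasis_tendsto_0[OF K]]
    by (rule order_tendstoD) (use \<open>0 < real k\<close> in simp)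
  then obtain M where M: "\<And>n. n \<ge> M \<Longrightarrow> norm (K (ebasis n)) < 1 / (2 * real k)"
    unfolding eventually_sequentially by blast
  have "real k * cmod (Rep_ell2 (K (ebasis n)) i) \<le> 1 / 2" if "n \<ge> M" for n i
  proof -
    have "cmod (Rep_ell2 (K (ebasis n)) i) \<le> 1 / (2 * real k)"
      using cmod_Rep_ell2_le_norm[of "K (ebasis n)" i] M[OF that] by linarith
    from mult_left_mono[OF this, of "real k"] show ?thesis
      using \<open>0 < real k\<close> by simp
  qed
  moreover have "norm K \<le> real k" using k1 by (simp add: k_def)
  ultimately have "K \<in> pinched a b k M" using cl 1 by (simp add: pinched_def)
  then show thesis by (rule that)
qed


section \<open>The commutant of \<open>A + \<delta> S\<close>\<close>

text \<open>The monic polynomial in \<open>A\<close> with roots listed with multiplicity; the head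
  factor acts first. The list form lets an induction remove one root at a time.\<close>

fun factors :: "(ell2 \<Rightarrow>\<^sub>L ell2) \<Rightarrow> complex list \<Rightarrow> ell2 \<Rightarrow>\<^sub>L ell2" where
  "factors A [] = id_blinfun"
| "factors A (l # ls) = factors A ls o\<^sub>L (A - cscale l)"

lemma factors_append: "factors A (ls @ ms) x = factors A ms (factors A ls x)"
  by (induction ls arbitrary: x) simp_all

lemma factors_clinear:
  assumes "A \<in> clinear_operators"
  shows "factors A ls \<in> clinear_operators"
proof (induction ls)
  case Nil
  then show ?case by (simp add: clinear_operators_def)
next
  case (Cons l ls)
  have "A (c *\<^sub>C x) - l *\<^sub>C c *\<^sub>C x = c *\<^sub>C (A x - l *\<^sub>C x)" for c x
    by (rule ell2_eqI) (simp add: clinear_operators_scaleC[OF assms] Rep_ell2_simps algebra_simps)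
  with Cons show ?case
    by (simp add: clinear_operators_def blinfun.diff_left)
qed

lemma factors_commute:
  fixes A B :: "ell2 \<Rightarrow>\<^sub>L ell2"
  assumes "B \<in> clinear_operators" and "\<And>x. B (A x) = A (B x)"
  shows "B (factors A ls x) = factors A ls (B x)"
proof (induction ls arbitrary: x)
  case (Cons l ls)
  show ?case
    by (simp add: Cons assms(2) blinfun.diff_left blinfun.diff_right clinear_operators_scaleC[OF assms(1)])
qed simp

lemma factors_apply_commute:
  assumes "A \<in> clinear_operators"
  shows "factors A ms (factors A ls x) = factors A ls (factors A ms x)"
  by (rule factors_commute[OF factors_clinear[OF assms]], rule factors_commute[OF assms, symmetric]) simp

text \<open>If \<open>S\<close> commutes with \<open>Y = [S, K]\<close>, then
  \<open>[S^n, K] = n S^(n-1) Y\<close>. For an isometry the right side applied to \<open>x\<close>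
  has norm \<open>n * norm (Y x)\<close>, while the left side stays bounded in
  \<open>n\<close>.\<close>

lemma isometry_commutator_eq_0:
  fixes S K Y :: "'a::real_normed_vector \<Rightarrow>\<^sub>L 'a"
  assumes iso: "\<And>x. norm (S x) = norm x"
    and Y: "\<And>x. Y x = S (K x) - K (S x)" and SY: "\<And>x. S (Y x) = Y (S x)"
  shows "Y = 0"
proof (rule blinfun_eqI)
  fix x
  have add: "(blinfun_apply S ^^ n) (u + v) = (blinfun_apply S ^^ n) u + (blinfun_apply S ^^ n) v" for n u v
    by (induction n) (simp_all add: blinfun.add_right)
  have iso_n: "norm ((blinfun_apply S ^^ n) u) = norm u" for n u
    by (induction n) (simp_all add: iso)
  \<comment> \<open>For \<open>n = 0\<close> the truncated exponent \<open>n - 1\<close> is harmless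
    because its coefficient vanishes.\<close>
  have "(blinfun_apply S ^^ n) (K x) - K ((blinfun_apply S ^^ n) x) = real n *\<^sub>R (blinfun_apply S ^^ (n - 1)) (Y x)" for n x
  proof (induction n arbitrary: x)
    case (Suc n)
    have "(blinfun_apply S ^^ Suc n) (K x) = (blinfun_apply S ^^ n) (K (S x) + Y x)"
      by (simp add: funpow_swap1 Y del: funpow.simps(2) add: funpow_Suc_right)
    then have "(blinfun_apply S ^^ Suc n) (K x) - K ((blinfun_apply S ^^ Suc n) x)
        = ((blinfun_apply S ^^ n) (K (S x)) - K ((blinfun_apply S ^^ n) (S x))) + (blinfun_apply S ^^ n) (Y x)"
      by (simp add: add funpow_Suc_right del: funpow.simps(2))
    also have "(blinfun_apply S ^^ n) (K (S x)) - K ((blinfun_apply S ^^ n) (S x)) = real n *\<^sub>R (blinfun_apply S ^^ (n - 1)) (S (Y x))"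
      unfolding Suc.IH SY ..
    also have "\<dots> = real n *\<^sub>R (blinfun_apply S ^^ n) (Y x)"
      by (cases n) (simp_all add: funpow_Suc_right del: funpow.simps(2))
    finally show ?case by (simp add: algebra_simps)
  qed simp
  then have eq: "real n *\<^sub>R (blinfun_apply S ^^ (n - 1)) (Y x) = (blinfun_apply S ^^ n) (K x) - K ((blinfun_apply S ^^ n) x)" for n
    by simp
  have le: "real n * norm (Y x) \<le> norm (K x) + norm K * norm x" for n
  proof -
    have "real n * norm (Y x) = norm (real n *\<^sub>R (blinfun_apply S ^^ (n - 1)) (Y x))"
      by (simp add: iso_n)
    also have "\<dots> \<le> norm ((blinfun_apply S ^^ n) (K x)) + norm (K ((blinfun_apply S ^^ n) x))"
      unfolding eq by (rule norm_triangle_ineq4)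
    also have "\<dots> \<le> norm (K x) + norm K * norm x"
      using norm_blinfun[of K "(blinfun_apply S ^^ n) x"] by (simp add: iso_n)
    finally show ?thesis .
  qed
  have "norm (Y x) \<le> 0"
  proof (rule ccontr)
    assume "\<not> ?thesis"
    then obtain n :: nat where "norm (K x) + norm K * norm x < real n * norm (Y x)"
      using reals_Archimedean3 by (meson not_le)
    with le[of n] show False by simp
  qed
  then show "Y x = blinfun_apply 0 x" by simp
qed

text \<open>Peeling off one factor on either side shows that \<open>S\<close> commutes with \<open>(A - l) K\<close> and
  \<open>K (A - m)\<close>, hence with their difference \<open>- \<delta> [S, K] - (l - m) K\<close>. So the commutator
  \<open>Y = [S, K]\<close> satisfies \<open>\<delta> [S, Y] = - (l - m) Y\<close>, which forces \<open>Y = 0\<close>: for \<open>l \<noteq> m\<close> by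
  comparing norms, for \<open>l = m\<close> because \<open>S\<close> is an isometry.\<close>

lemma commutant_scaled_isometry:
  fixes A S K :: "ell2 \<Rightarrow>\<^sub>L ell2" and \<delta> :: real
  assumes A: "A \<in> clinear_operators" and S: "S \<in> clinear_operators"
    and iso: "\<And>x. norm (S x) = norm x" and AS: "\<And>x. A (S x) = S (A x)"
    and \<delta>: "\<delta> > 0"
    and K: "K \<in> clinear_operators"
      "\<And>x. A (K x) + \<delta> *\<^sub>R S (K x) = K (A x) + \<delta> *\<^sub>R K (S x)"
    and ls: "\<And>x. factors A ls (K x) = 0" and ms: "\<And>x. K (factors A ms x) = 0"
    and sep: "\<And>l m. l \<in> set ls \<Longrightarrow> m \<in> set ms \<Longrightarrow> l \<noteq> m \<Longrightarrow> 2 * \<delta> < cmod (l - m)"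
  shows "S (K x) = K (S x)"
  using K ls ms sep
\<comment> \<open>\<open>K\<close> must be arbitrary: the hypothesis is applied to \<open>U\<close>,
  with a shorter left list, and to \<open>V\<close>, with a shorter right list.\<close>
proof (induction "length ls + length ms" arbitrary: K ls ms x rule: less_induct)
  case less
  note K = less.prems(1,2) and ls = less.prems(3) and ms = less.prems(4) and sep = less.prems(5)
  show ?case
  proof (cases "ls = [] \<or> ms = []")
    case True
    \<comment> \<open>The empty product is the identity, so one of the two annihilation assumptions
      already says that \<open>K\<close> vanishes.\<close>
    then have "K y = 0" for y using ls[of y] ms[of y] by auto
    then show ?thesis by simp
  next
    case False
    then obtain l ls' m ms' where ls_eq: "ls = l # ls'" and ms_eq: "ms = m # ms'"
      by (auto simp: neq_Nil_conv)
    note cl = clinear_operators_scaleC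
    define U where "U = (A - cscale l) o\<^sub>L K"
    define V where "V = K o\<^sub>L (A - cscale m)"
    have Ux: "U x = A (K x) - l *\<^sub>C K x" for x
      by (simp add: U_def blinfun.diff_left)
    have Vx: "V x = K (A x) - m *\<^sub>C K x" for x
      by (simp add: V_def blinfun.diff_left blinfun.diff_right cl[OF K(1)])
    have KS: "\<delta> *\<^sub>R K (S x) = A (K x) + \<delta> *\<^sub>R S (K x) - K (A x)" for x
      using K(2)[of x] by (simp add: algebra_simps)
    have Rs: "s *\<^sub>R c *\<^sub>C (y :: ell2) = c *\<^sub>C s *\<^sub>R y" for s c y
      by (rule ell2_eqI) (simp add: Rep_ell2_simps)
    have "S (U x) = U (S x)" for x
    proof (rule less.hyps[of ls' ms])
      show "U \<in> clinear_operators"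
        unfolding clinear_operators_def mem_Collect_eq Ux cl[OF A] cl[OF K(1)]
        by (auto intro!: ell2_eqI simp: Rep_ell2_simps algebra_simps)
      \<comment> \<open>\<open>A - l\<close> commutes with \<open>A\<close> and with
        \<open>S\<close>, so composing \<open>K\<close> with it preserves commutation with
        \<open>A + \<delta> S\<close>; the same holds for \<open>V\<close> below.\<close>
      show "A (U x) + \<delta> *\<^sub>R S (U x) = U (A x) + \<delta> *\<^sub>R U (S x)" for x
      proof -
        have "\<delta> *\<^sub>R U (S x) = A (\<delta> *\<^sub>R K (S x)) - l *\<^sub>C (\<delta> *\<^sub>R K (S x))"
          by (simp add: Ux blinfun.scaleR_right scaleR_diff_right Rs)
        also have "\<dots> = A (A (K x)) + \<delta> *\<^sub>R S (A (K x)) - A (K (A x))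
            - l *\<^sub>C (A (K x) + \<delta> *\<^sub>R S (K x) - K (A x))"
          unfolding KS by (simp add: blinfun.add_right blinfun.diff_right blinfun.scaleR_right AS)
        finally show ?thesis
          by (simp only: Ux blinfun.diff_right cl[OF A] cl[OF S])
            (auto intro!: ell2_eqI simp: Rep_ell2_simps algebra_simps)
      qed
      show "factors A ls' (U x) = 0" for x
        using ls[of x] by (simp add: ls_eq U_def)
      show "U (factors A ms x) = 0" for x
        by (simp add: U_def ms)
    qed (use sep ls_eq in auto)
    moreover have "S (V x) = V (S x)" for x
    proof (rule less.hyps[of ls ms'])
      show "V \<in> clinear_operators"
        unfolding clinear_operators_def mem_Collect_eq Vx cl[OF A] cl[OF K(1)]
        by (auto intro!: ell2_eqI simp: Rep_ell2_simps algebra_simps)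
      show "A (V x) + \<delta> *\<^sub>R S (V x) = V (A x) + \<delta> *\<^sub>R V (S x)" for x
      proof -
        have "\<delta> *\<^sub>R V (S x) = \<delta> *\<^sub>R K (S (A x)) - m *\<^sub>C (\<delta> *\<^sub>R K (S x))"
          by (simp add: Vx AS scaleR_diff_right Rs)
        also have "\<dots> = A (K (A x)) + \<delta> *\<^sub>R S (K (A x)) - K (A (A x))
            - m *\<^sub>C (A (K x) + \<delta> *\<^sub>R S (K x) - K (A x))"
          unfolding KS ..
        finally show ?thesis
          by (simp only: Vx blinfun.diff_right cl[OF A] cl[OF S])
            (auto intro!: ell2_eqI simp: Rep_ell2_simps algebra_simps)
      qed
      show "factors A ls (V x) = 0" for x
        by (simp add: V_def ls)
      \<comment> \<open>The head factor of \<open>ms\<close> acts first, so it has to be moved past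
        the others to stand next to \<open>K\<close>.\<close>
      have "factors A ms' (A x - m *\<^sub>C x) = A (factors A ms' x) - m *\<^sub>C factors A ms' x" for x
        using factors_commute[OF A, of A] clinear_operators_scaleC[OF factors_clinear[OF A]]
        by (simp add: blinfun.diff_right)
      then show "V (factors A ms' x) = 0" for x
        using ms[of x] by (simp add: ms_eq V_def blinfun.diff_left)
    qed (use sep ms_eq in auto)
    ultimately have SD: "S (U x - V x) = U (S x) - V (S x)" for x
      by (simp add: blinfun.diff_right)
    define Y where "Y = (S o\<^sub>L K) - (K o\<^sub>L S)"
    have Yx: "Y x = S (K x) - K (S x)" for x by (simp add: Y_def blinfun.diff_left)
    have D: "U x - V x = - (\<delta> *\<^sub>R Y x) - (l - m) *\<^sub>C K x" for x
    proof -
      have "U x - V x = (A (K x) - K (A x)) - (l - m) *\<^sub>C K x"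
        unfolding Ux Vx by (rule ell2_eqI) (simp add: Rep_ell2_simps algebra_simps)
      moreover have "A (K x) - K (A x) = - (\<delta> *\<^sub>R Y x)"
        using KS[of x] by (simp add: Yx algebra_simps)
      ultimately show ?thesis by simp
    qed
    have SY: "\<delta> *\<^sub>R (S (Y x) - Y (S x)) = - ((l - m) *\<^sub>C Y x)" for x
    proof -
      have "- (\<delta> *\<^sub>R S (Y x)) - (l - m) *\<^sub>C S (K x) = - (\<delta> *\<^sub>R Y (S x)) - (l - m) *\<^sub>C K (S x)"
        using SD[of x] unfolding D
        by (simp add: blinfun.diff_right blinfun.minus_right blinfun.scaleR_right cl[OF S])
      then have "\<delta> *\<^sub>R (S (Y x) - Y (S x)) = (l - m) *\<^sub>C K (S x) - (l - m) *\<^sub>C S (K x)"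
        by (simp add: algebra_simps)
      also have "\<dots> = - ((l - m) *\<^sub>C Y x)"
        unfolding Yx by (rule ell2_eqI) (simp add: Rep_ell2_simps algebra_simps)
      finally show ?thesis .
    qed
    have "Y = 0"
    proof (cases "l = m")
      case True
      have "(0 :: complex) *\<^sub>C y = 0" for y :: ell2
        by (rule ell2_eqI) (simp add: Rep_ell2_simps)
      then have "S (Y x) = Y (S x)" for x using SY[of x] \<delta> True by simp
      then show ?thesis by (rule isometry_commutator_eq_0[OF iso Yx])
    next
      case False
      \<comment> \<open>Since \<open>norm (S x) = norm x\<close>, the commutator of \<open>S\<close>
        and \<open>Y\<close> has norm at most \<open>2 * norm Y\<close>. With the gap assumed
        between distinct roots this forces \<open>norm Y = 0\<close>.\<close>
      have "cmod (l - m) * norm Y \<le> 2 * \<delta> * norm Y"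
      proof (subst norm_cscale_compose[symmetric], rule norm_blinfun_bound)
        fix x
        have "norm ((cscale (l - m) o\<^sub>L Y) x) = \<delta> * norm (S (Y x) - Y (S x))"
          using arg_cong[OF SY[of x], of norm] \<delta> by simp
        also have "\<dots> \<le> \<delta> * (norm (S (Y x)) + norm (Y (S x)))"
          using \<delta> by (intro mult_left_mono norm_triangle_ineq4) auto
        also have "\<dots> \<le> \<delta> * (norm Y * norm x + norm Y * norm x)"
          using norm_blinfun[of Y x] norm_blinfun[of Y "S x"] \<delta>
          by (intro mult_left_mono add_mono) (auto simp: iso)
        finally show "norm ((cscale (l - m) o\<^sub>L Y) x) \<le> 2 * \<delta> * norm Y * norm x"
          by (simp add: algebra_simps)
      qed (use \<delta> in simp)
      moreover have "2 * \<delta> < cmod (l - m)" using sep False ls_eq ms_eq by simp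
      ultimately have "norm Y = 0"
        by (metis linorder_not_le mult_less_cancel_right norm_ge_zero order_le_less)
      then show ?thesis by simp
    qed
    then show ?thesis using Yx[of x] by simp
  qed
qed


section \<open>Annihilating products of linear factors\<close>

text \<open>The vectors form an indexed family: a repetition is itself a relation, and otherwise the
  dimension bound applies.\<close>

lemma span_linear_relation:
  fixes f :: "nat \<Rightarrow> 'v::real_vector"
  assumes B: "finite B" "card B < m" and f: "\<And>i. i < m \<Longrightarrow> f i \<in> span B"
  obtains u where "\<exists>i<m. u i \<noteq> 0" "(\<Sum>i<m. u i *\<^sub>R f i) = 0"
proof (cases "inj_on f {..<m}")
  case True
  have "\<not> independent (f ` {..<m})"
  proof
    assume "independent (f ` {..<m})"
    then have "card (f ` {..<m}) \<le> card B"
      using independent_span_bound[OF B(1)] f by blast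
    then show False using B(2) card_image[OF True] by simp
  qed
  then obtain c v where v: "v \<in> f ` {..<m}" "c v \<noteq> 0" and c: "(\<Sum>v\<in>f ` {..<m}. c v *\<^sub>R v) = 0"
    using dependent_finite[of "f ` {..<m}"] by blast
  have "(\<Sum>i<m. c (f i) *\<^sub>R f i) = 0"
    using c by (simp add: sum.reindex[OF True])
  with v show ?thesis by (intro that[of "\<lambda>i. c (f i)"]) auto
next
  case False
  then obtain i j where ij: "i < m" "j < m" "i \<noteq> j" "f i = f j"
    unfolding inj_on_def by auto
  define u where "u k = (if k = i then 1 else 0) - (if k = j then 1 else 0 :: real)" for k
  have "(\<Sum>k<m. u k *\<^sub>R f k)
      = (\<Sum>k<m. if k = i then f k else 0) - (\<Sum>k<m. if k = j then f k else 0)"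
    unfolding sum_subtractf[symmetric] u_def by (rule sum.cong) (auto simp: scaleR_left_diff_distrib)
  also have "\<dots> = 0" using ij by simp
  finally have "(\<Sum>k<m. u k *\<^sub>R f k) = 0" .
  moreover have "u i \<noteq> 0" using ij by (simp add: u_def)
  ultimately show ?thesis using ij by (intro that[of u]) auto
qed

text \<open>A complex root \<open>z\<close> of \<open>p\<close> splits off the factor
  \<open>A - z\<close>, and the quotient \<open>q\<close> then annihilates \<open>(A - z) x\<close>.
  The number \<open>m\<close> of terms is kept separate from the degree and drops by one with
  it.\<close>

lemma factors_of_poly:
  fixes A :: "ell2 \<Rightarrow>\<^sub>L ell2" and p :: "complex poly"
  assumes A: "A \<in> clinear_operators"
  assumes "p \<noteq> 0" "degree p < m" "(\<Sum>i<m. coeff p i *\<^sub>C (blinfun_apply A ^^ i) x) = 0"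
  shows "\<exists>ls. factors A ls x = 0"
  using assms(2-)
proof (induction "degree p" arbitrary: p m x)
  case 0
  then obtain c where p: "p = [:c:]" "c \<noteq> 0" by (metis degree_eq_zeroE pCons_0_0)
  obtain m' where m: "m = Suc m'" using 0 by (cases m) auto
  have z: "(0 :: complex) *\<^sub>C y = 0" for y :: ell2
    by (rule ell2_eqI) (simp add: Rep_ell2_simps)
  have "c *\<^sub>C x = 0"
    using 0(4) by (simp add: m sum.lessThan_Suc_shift p z del: sum.lessThan_Suc)
  then have "norm (c *\<^sub>C x) = 0" by simp
  then have "x = 0" using p by (simp add: norm_scaleC)
  then show ?case by (intro exI[of _ "[]"]) simp
next
  case (Suc d)
  then have "\<not> constant (poly p)" by (simp add: constant_degree)
  then obtain z where "poly p z = 0" using fundamental_theorem_of_algebra by blast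
  then obtain q where q: "p = [:- z, 1:] * q" by (auto simp: poly_eq_0_iff_dvd dvd_def)
  have q0: "q \<noteq> 0" using Suc.prems(1) q by auto
  have dq: "degree p = Suc (degree q)"
    unfolding q by (subst degree_mult_eq) (use q0 in auto)
  obtain m' where m: "m = Suc m'" using Suc.prems(2) by (cases m) auto
  have cq: "coeff p i = coeff (pCons 0 q) i - z * coeff q i" for i
    by (simp add: q)
  let ?A = "blinfun_apply A"
  have lin: "(?A ^^ i) (A x - z *\<^sub>C x) = (?A ^^ Suc i) x - z *\<^sub>C (?A ^^ i) x" for i
    by (induction i) (simp_all add: blinfun.diff_right clinear_operators_scaleC[OF A])
  have "(\<Sum>i<m'. coeff q i *\<^sub>C (?A ^^ i) (A x - z *\<^sub>C x)) = (\<Sum>i<m. coeff p i *\<^sub>C (?A ^^ i) x)"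
  proof (rule ell2_eqI)
    fix n
    \<comment> \<open>\<open>q\<close> has degree below \<open>m'\<close>, so the sum with
      coefficients of \<open>q\<close> may stop one term earlier than the sum for
      \<open>p\<close>.\<close>
    have "coeff q m' = 0" using Suc.prems(2) dq m by (simp add: coeff_eq_0)
    moreover have "(\<Sum>i<m. coeff (pCons 0 q) i * Rep_ell2 ((?A ^^ i) x) n)
        = (\<Sum>i<m'. coeff q i * Rep_ell2 ((?A ^^ Suc i) x) n)"
      unfolding m sum.lessThan_Suc_shift by simp
    ultimately show "Rep_ell2 (\<Sum>i<m'. coeff q i *\<^sub>C (?A ^^ i) (A x - z *\<^sub>C x)) n
        = Rep_ell2 (\<Sum>i<m. coeff p i *\<^sub>C (?A ^^ i) x) n"
      unfolding lin cq Rep_ell2_simps left_diff_distrib right_diff_distrib sum_subtractf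
      by (simp add: m mult.left_commute mult.assoc)
  qed
  with Suc.prems(3) have "(\<Sum>i<m'. coeff q i *\<^sub>C (?A ^^ i) (A x - z *\<^sub>C x)) = 0" by simp
  from Suc.hyps(1)[OF _ q0 _ this] Suc.hyps(2) Suc.prems(2) dq m
  obtain ls where "factors A ls (A x - z *\<^sub>C x) = 0" by auto
  then show ?case by (intro exI[of _ "z # ls"]) (simp add: blinfun.diff_left)
qed

text \<open>The vectors supported on the first \<open>N\<close> coordinates form an invariant
  subspace of real dimension at most \<open>2 * N\<close>. Hence the first \<open>2 * N + 1\<close>
  iterates of \<open>x\<close> satisfy a linear relation, that is, a polynomial in \<open>A\<close>
  kills \<open>x\<close>.\<close>

lemma factors_annihilate_vector:
  fixes A :: "ell2 \<Rightarrow>\<^sub>L ell2"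
  assumes A: "A \<in> clinear_operators"
    and inv: "\<And>x n. trunc N x = x \<Longrightarrow> trunc N (A x) = A x"
    and x: "trunc N x = x"
  shows "\<exists>ls. factors A ls x = 0"
proof -
  \<comment> \<open>Spans are taken over the reals, so the multiples of the basis by
    \<open>\<i>\<close> are listed as well.\<close>
  define B where "B = ebasis ` {..<N} \<union> (\<lambda>n. \<i> *\<^sub>C ebasis n) ` {..<N}"
  have fB: "finite B" by (simp add: B_def)
  have "card B \<le> card (ebasis ` {..<N}) + card ((\<lambda>n. \<i> *\<^sub>C ebasis n) ` {..<N})"
    unfolding B_def by (rule card_Un_le)
  also have "\<dots> \<le> N + N"
    by (intro add_mono order_trans[OF card_image_le]) auto
  finally have cB: "card B < Suc (2 * N)" by simp
  have E: "y \<in> span B" if "trunc N y = y" for y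
  proof -
    have "y = (\<Sum>n<N. Rep_ell2 y n *\<^sub>C ebasis n)" using that trunc_eq_sum by metis
    also have "\<dots> = (\<Sum>n<N. Re (Rep_ell2 y n) *\<^sub>R ebasis n + Im (Rep_ell2 y n) *\<^sub>R (\<i> *\<^sub>C ebasis n))"
    proof (rule sum.cong[OF refl])
      fix n
      show "Rep_ell2 y n *\<^sub>C ebasis n
          = Re (Rep_ell2 y n) *\<^sub>R ebasis n + Im (Rep_ell2 y n) *\<^sub>R (\<i> *\<^sub>C ebasis n)"
        by (rule ell2_eqI) (auto simp: Rep_ell2_simps ebasis.rep_eq complex_eq_iff)
    qed
    also have "\<dots> \<in> span B"
      by (intro span_sum span_add span_scale span_base) (auto simp: B_def)
    finally show ?thesis .
  qed
  have "trunc N ((blinfun_apply A ^^ i) x) = (blinfun_apply A ^^ i) x" for i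
    by (induction i) (simp_all add: x inv)
  then obtain u where u: "\<exists>i<Suc (2 * N). u i \<noteq> 0"
    "(\<Sum>i<Suc (2 * N). u i *\<^sub>R (blinfun_apply A ^^ i) x) = 0"
    using span_linear_relation[OF fB cB, of "\<lambda>i. (blinfun_apply A ^^ i) x"] E by blast
  define p where "p = (\<Sum>i<Suc (2 * N). monom (complex_of_real (u i)) i)"
  have cp: "coeff p i = (if i < Suc (2 * N) then complex_of_real (u i) else 0)" for i
    by (simp add: p_def coeff_sum del: sum.lessThan_Suc)
  have "p \<noteq> 0"
    using u(1) cp by (metis coeff_0 of_real_eq_0_iff)
  moreover have "degree p < Suc (2 * N)"
    by (rule degree_lessI) (auto simp: cp \<open>p \<noteq> 0\<close>)
  moreover have "(\<Sum>i<Suc (2 * N). coeff p i *\<^sub>C (blinfun_apply A ^^ i) x) = 0"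
    unfolding u(2)[symmetric]
    by (rule sum.cong[OF refl], rule ell2_eqI) (auto simp: cp Rep_ell2_simps scaleR_conv_of_real)
  ultimately show ?thesis by (rule factors_of_poly[OF A])
qed

lemma trunc_ebasis: "k < N \<Longrightarrow> trunc N (ebasis k) = ebasis k"
  by (rule ell2_eqI) (simp add: trunc.rep_eq ebasis.rep_eq)

text \<open>Concatenating lists multiplies the polynomials. As these commute, each basis vector
  remains killed by its own factor.\<close>

lemma factors_annihilate_ebasis:
  fixes A :: "ell2 \<Rightarrow>\<^sub>L ell2"
  assumes A: "A \<in> clinear_operators"
    and inv: "\<And>x. trunc N x = x \<Longrightarrow> trunc N (A x) = A x"
  obtains ls where "\<And>k. k < N \<Longrightarrow> factors A ls (ebasis k) = 0"
proof -
  have "\<exists>ls. \<forall>k<j. factors A ls (ebasis k) = 0" if "j \<le> N" for j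
    using that
  proof (induction j)
    case (Suc j)
    then obtain ls where ls: "\<And>k. k < j \<Longrightarrow> factors A ls (ebasis k) = 0" by auto
    obtain ms where ms: "factors A ms (ebasis j) = 0"
      using factors_annihilate_vector[OF A inv trunc_ebasis[of j N]] Suc.prems by auto
    have "factors A (ls @ ms) (ebasis k) = 0" if "k < Suc j" for k
    proof (cases "k < j")
      case False
      then have "k = j" using that by simp
      then show ?thesis
        by (simp add: factors_append factors_apply_commute[OF A, of ms ls] ms)
    qed (simp add: factors_append ls)
    then show ?case by blast
  qed simp
  from this[of N] show thesis using that by blast
qed

section \<open>Shifts and block diagonal operators\<close>

lift_definition shift_fun :: "nat \<Rightarrow> ell2 \<Rightarrow> ell2" is "\<lambda>N x n. if n < N then 0 else x (n - N)"
proof -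
  fix N and x :: "nat \<Rightarrow> complex"
  assume "summable (\<lambda>n. (cmod (x n))\<^sup>2)"
  then show "summable (\<lambda>n. (cmod (if n < N then 0 else x (n - N)))\<^sup>2)"
    by (subst summable_iff_shift[symmetric, of _ N]) simp
qed

lemma norm_shift_fun: "norm (shift_fun N x) = norm x"
proof -
  have "(norm (shift_fun N x))\<^sup>2 = (norm x)\<^sup>2"
    using suminf_split_initial_segment[OF summable_Rep_ell2, of "shift_fun N x" N]
    unfolding norm_ell2_power2 by (simp add: shift_fun.rep_eq)
  then show ?thesis by simp
qed

definition Shift :: "nat \<Rightarrow> ell2 \<Rightarrow>\<^sub>L ell2" where
  "Shift N = Blinfun (shift_fun N)"

lemma Shift_apply: "Shift N x = shift_fun N x"
proof -
  have "bounded_linear (shift_fun N)"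
    by (rule bounded_linear_intro[where K = 1])
      (auto intro!: ell2_eqI simp: Rep_ell2_simps shift_fun.rep_eq norm_shift_fun)
  then show ?thesis by (simp add: Shift_def bounded_linear_Blinfun_apply)
qed

lemma Rep_Shift: "Rep_ell2 (Shift N x) n = (if n < N then 0 else Rep_ell2 x (n - N))"
  by (simp add: Shift_apply shift_fun.rep_eq)

lemma norm_Shift_apply: "norm (Shift N x) = norm x"
  by (simp add: Shift_apply norm_shift_fun)

lemma Shift_clinear: "Shift N \<in> clinear_operators"
  by (auto simp: clinear_operators_def intro!: ell2_eqI) (simp add: Rep_Shift Rep_ell2_simps)

lemma Shift_ebasis: "Shift N (ebasis k) = ebasis (k + N)"
  by (rule ell2_eqI) (auto simp: Rep_Shift ebasis.rep_eq)

section \<open>Block diagonal operators with equal blocks\<close>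

lift_definition block :: "nat \<Rightarrow> nat \<Rightarrow> ell2 \<Rightarrow> ell2" is "\<lambda>N q x s. if s < N then x (q * N + s) else 0"
  by (rule summable_finite[where N = "{..<N}" for N]) auto

lemma norm_block_power2: "(norm (block N q x))\<^sup>2 = (\<Sum>s<N. (cmod (Rep_ell2 x (q * N + s)))\<^sup>2)"
proof -
  have "(norm (block N q x))\<^sup>2 = (\<Sum>s<N. (cmod (Rep_ell2 (block N q x) s))\<^sup>2)"
    unfolding norm_ell2_power2 by (rule suminf_finite) (auto simp: block.rep_eq)
  then show ?thesis by (simp add: block.rep_eq)
qed

text \<open>Coordinate \<open>n\<close> has position \<open>n mod N\<close> in block
  \<open>n div N\<close>, so this is the direct sum of infinitely many copies of the compression of
  \<open>T\<close> to the first \<open>N\<close> coordinates.\<close>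

definition blockdiag_fun :: "nat \<Rightarrow> (ell2 \<Rightarrow>\<^sub>L ell2) \<Rightarrow> ell2 \<Rightarrow> ell2" where
  "blockdiag_fun N T x = Abs_ell2 (\<lambda>n. Rep_ell2 (T (block N (n div N) x)) (n mod N))"

lemma sum_blocks: "(\<Sum>n<M * N. f n) = (\<Sum>q<M. \<Sum>s<N. f (q * N + s))" for f :: "nat \<Rightarrow> real"
proof -
  have "(\<Sum>n=q * N..<q * N + N. f n) = (\<Sum>s<N. f (q * N + s))" for q
    using sum.shift_bounds_nat_ivl[of f 0 "q * N" N] by (simp add: lessThan_atLeast0 add.commute)
  then show ?thesis by (simp only: sum.nat_group[symmetric])
qed

text \<open>The blocks are orthogonal and each is enlarged by at most the factor
  \<open>norm T\<close>, so the squares add up. The range is first extended to \<open>M * N\<close>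
  so that it consists of whole blocks.\<close>

lemma blockdiag_sum_le:
  fixes T :: "ell2 \<Rightarrow>\<^sub>L ell2"
  assumes N: "N > 0"
  shows "(\<Sum>n<M. (cmod (Rep_ell2 (T (block N (n div N) x)) (n mod N)))\<^sup>2) \<le> (norm T * norm x)\<^sup>2"
proof -
  let ?f = "\<lambda>n. (cmod (Rep_ell2 (T (block N (n div N) x)) (n mod N)))\<^sup>2"
  have "sum ?f {..<M} \<le> sum ?f {..<M * N}"
    using N by (intro sum_mono2) auto
  also have "\<dots> = (\<Sum>q<M. \<Sum>s<N. (cmod (Rep_ell2 (T (block N q x)) s))\<^sup>2)"
    unfolding sum_blocks by (intro sum.cong refl) simp
  also have "\<dots> \<le> (\<Sum>q<M. (norm T)\<^sup>2 * (\<Sum>s<N. (cmod (Rep_ell2 x (q * N + s)))\<^sup>2))"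
  proof (rule sum_mono)
    fix q
    have "(\<Sum>s<N. (cmod (Rep_ell2 (T (block N q x)) s))\<^sup>2) \<le> (norm (T (block N q x)))\<^sup>2"
      by (rule sum_le_norm_ell2_power2) simp
    also have "\<dots> \<le> (norm T * norm (block N q x))\<^sup>2"
      by (intro power_mono norm_blinfun) simp
    finally show "(\<Sum>s<N. (cmod (Rep_ell2 (T (block N q x)) s))\<^sup>2)
        \<le> (norm T)\<^sup>2 * (\<Sum>s<N. (cmod (Rep_ell2 x (q * N + s)))\<^sup>2)"
      by (simp add: power_mult_distrib norm_block_power2)
  qed
  also have "\<dots> = (norm T)\<^sup>2 * (\<Sum>n<M * N. (cmod (Rep_ell2 x n))\<^sup>2)"
    by (simp add: sum_blocks sum_distrib_left)
  also have "\<dots> \<le> (norm T)\<^sup>2 * (norm x)\<^sup>2"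
    by (intro mult_left_mono sum_le_norm_ell2_power2) auto
  finally show ?thesis by (simp add: power_mult_distrib)
qed

definition blockdiag :: "nat \<Rightarrow> (ell2 \<Rightarrow>\<^sub>L ell2) \<Rightarrow> ell2 \<Rightarrow>\<^sub>L ell2" where
  "blockdiag N T = Blinfun (blockdiag_fun N T)"

context
  fixes N :: nat and T :: "ell2 \<Rightarrow>\<^sub>L ell2"
  assumes N: "N > 0"
begin

lemma Rep_blockdiag_fun:
  "Rep_ell2 (blockdiag_fun N T x) n = Rep_ell2 (T (block N (n div N) x)) (n mod N)"
  unfolding blockdiag_fun_def by (subst bounded_partial_sums_ell2(2)[OF blockdiag_sum_le[OF N]]) simp

lemma norm_blockdiag_fun: "norm (blockdiag_fun N T x) \<le> norm T * norm x"
  by (rule power2_le_imp_le)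
    (use bounded_partial_sums_ell2(3)[OF blockdiag_sum_le[OF N]] in \<open>simp_all add: blockdiag_fun_def\<close>)

lemma blockdiag_apply: "blockdiag N T x = blockdiag_fun N T x"
proof -
  have add: "block N q (x + y) = block N q x + block N q y" for q x y
    by (rule ell2_eqI) (simp add: Rep_ell2_simps block.rep_eq)
  have scale: "block N q (r *\<^sub>R x) = r *\<^sub>R block N q x" for q x r
    by (rule ell2_eqI) (simp add: Rep_ell2_simps block.rep_eq)
  have "bounded_linear (blockdiag_fun N T)"
    by (rule bounded_linear_intro[where K = "norm T"])
      (auto intro!: ell2_eqI simp: Rep_ell2_simps Rep_blockdiag_fun add scale blinfun.add_right
        blinfun.scaleR_right norm_blockdiag_fun mult.commute[of _ "norm T"])
  then show ?thesis by (simp add: blockdiag_def bounded_linear_Blinfun_apply)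
qed

lemma Rep_blockdiag:
  "Rep_ell2 (blockdiag N T x) n = Rep_ell2 (T (block N (n div N) x)) (n mod N)"
  by (simp add: blockdiag_apply Rep_blockdiag_fun)

lemma norm_blockdiag: "norm (blockdiag N T) \<le> norm T"
  by (rule norm_blinfun_bound) (simp_all add: blockdiag_apply norm_blockdiag_fun)

lemma blockdiag_clinear:
  assumes "T \<in> clinear_operators"
  shows "blockdiag N T \<in> clinear_operators"
proof -
  have scale: "block N q (c *\<^sub>C x) = c *\<^sub>C block N q x" for q x c
    by (rule ell2_eqI) (simp add: Rep_ell2_simps block.rep_eq)
  show ?thesis
    unfolding clinear_operators_def
    by (auto intro!: ell2_eqI simp: Rep_blockdiag scale clinear_operators_scaleC[OF assms] Rep_ell2_simps)
qed

text \<open>All blocks carry the same operator, and the shift by \<open>N\<close> moves each block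
  onto the next.\<close>

lemma blockdiag_Shift: "blockdiag N T (Shift N x) = Shift N (blockdiag N T x)"
proof (rule ell2_eqI)
  fix n
  show "Rep_ell2 (blockdiag N T (Shift N x)) n = Rep_ell2 (Shift N (blockdiag N T x)) n"
  proof (cases "n < N")
    case True
    have "block N 0 (Shift N x) = 0"
      by (rule ell2_eqI) (simp add: block.rep_eq Rep_Shift Rep_ell2_simps)
    with True show ?thesis by (simp add: Rep_blockdiag Rep_Shift Rep_ell2_simps)
  next
    case False
    have "block N (Suc q) (Shift N x) = block N q x" for q
      by (rule ell2_eqI) (simp add: block.rep_eq Rep_Shift)
    with False N show ?thesis
      by (simp add: Rep_blockdiag Rep_Shift le_div_geq le_mod_geq)
  qed
qed

lemma blockdiag_trunc: "blockdiag N T (trunc N x) = trunc N (T (trunc N x))"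
proof (rule ell2_eqI)
  fix n
  show "Rep_ell2 (blockdiag N T (trunc N x)) n = Rep_ell2 (trunc N (T (trunc N x))) n"
  proof (cases "n < N")
    case True
    have "block N 0 (trunc N x) = trunc N x"
      by (rule ell2_eqI) (simp add: block.rep_eq trunc.rep_eq)
    with True show ?thesis by (simp add: Rep_blockdiag trunc.rep_eq)
  next
    case False
    then have "n div N > 0" using N by (simp add: div_greater_zero_iff)
    then have "N \<le> n div N * N" by simp
    then have "\<not> n div N * N + s < N" for s by linarith
    then have "block N (n div N) (trunc N x) = 0"
      by (intro ell2_eqI) (simp add: block.rep_eq trunc.rep_eq Rep_ell2_simps)
    with False show ?thesis by (simp add: Rep_blockdiag trunc.rep_eq Rep_ell2_simps)
  qed
qed

text \<open>Finite dimension gives a product killing the first block. It commutes with the shift,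
  which carries the basis of each block to the next, so it kills every basis vector.\<close>

lemma factors_blockdiag_eq_0:
  assumes T: "T \<in> clinear_operators"
  obtains ls where "factors (blockdiag N T) ls = 0"
proof -
  note A = blockdiag_clinear[OF T]
  have inv: "trunc N (blockdiag N T x) = blockdiag N T x" if "trunc N x = x" for x
  proof -
    have "trunc N (trunc N y) = trunc N y" for y
      by (rule ell2_eqI) (simp add: trunc.rep_eq)
    then show ?thesis using blockdiag_trunc[of x] that by simp
  qed
  obtain ls where ls: "\<And>k. k < N \<Longrightarrow> factors (blockdiag N T) ls (ebasis k) = 0"
    using factors_annihilate_ebasis[OF A inv] by blast
  have "factors (blockdiag N T) ls (ebasis n) = 0" for n
  proof (induction n rule: less_induct)
    case (less n)
    show ?case
    proof (cases "n < N")
      case False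
      then have "ebasis n = Shift N (ebasis (n - N))" by (simp add: Shift_ebasis)
      moreover have "factors (blockdiag N T) ls (ebasis (n - N)) = 0"
        by (rule less) (use False N in simp)
      ultimately show ?thesis
        using factors_commute[OF Shift_clinear blockdiag_Shift[symmetric], of ls "ebasis (n - N)"]
        by simp
    qed (rule ls)
  qed
  then show thesis by (intro that[of ls] clinear_eq_0_on_basis factors_clinear A)
qed

end


section \<open>Density\<close>

lemma coord_blockdiag:
  assumes "n < N"
  shows "coord n o\<^sub>L blockdiag N T = (coord n o\<^sub>L T) o\<^sub>L Trunc N"
proof (rule blinfun_eqI)
  fix x
  have N: "N > 0" using assms by simp
  have "block N 0 x = trunc N x"
    by (rule ell2_eqI) (simp add: block.rep_eq trunc.rep_eq)
  then show "(coord n o\<^sub>L blockdiag N T) x = ((coord n o\<^sub>L T) o\<^sub>L Trunc N) x"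
    using assms by (simp add: Rep_blockdiag[OF N])
qed

text \<open>The margin \<epsilon> in the norm of \<open>T\<close> pays for \<delta> times the shift,
  and \<delta> is also less than half the least distance between distinct roots, so that
  \<open>commutant_scaled_isometry\<close> applies with \<open>ls\<close> on both sides.\<close>

lemma blockdiag_plus_Shift:
  assumes T: "T \<in> clinear_operators" and nT: "norm T \<le> 1 - \<epsilon>" and \<epsilon>: "\<epsilon> > 0" and N: "N > 0"
  obtains \<delta> where "0 < \<delta>" "\<delta> \<le> \<epsilon>" "blockdiag N T + \<delta> *\<^sub>R Shift N \<in> B1"
    "\<And>K x. K \<in> clinear_operators \<Longrightarrow>
       (blockdiag N T + \<delta> *\<^sub>R Shift N) o\<^sub>L K = K o\<^sub>L (blockdiag N T + \<delta> *\<^sub>R Shift N) \<Longrightarrow>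
       Shift N (blinfun_apply K x) = K (Shift N x)"
proof -
  note A = blockdiag_clinear[OF N T]
  obtain ls where ls: "factors (blockdiag N T) ls = 0"
    using factors_blockdiag_eq_0[OF N T] by blast
  \<comment> \<open>Inserting \<open>1\<close> keeps the set of root distances non-empty when there
    are no two distinct roots.\<close>
  define D where "D = insert 1 ((\<lambda>(l, m). cmod (l - m)) ` {(l, m) \<in> set ls \<times> set ls. l \<noteq> m})"
  have "finite {(l, m) \<in> set ls \<times> set ls. l \<noteq> m}"
    by (rule finite_subset[of _ "set ls \<times> set ls"]) auto
  then have fD: "finite D" by (simp add: D_def)
  have D0: "D \<noteq> {}" "\<And>d. d \<in> D \<Longrightarrow> 0 < d" by (auto simp: D_def)
  \<comment> \<open>A third, not a half, of the gap makes \<open>2 * \<delta> < Min D\<close>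
    strict.\<close>
  define \<delta> where "\<delta> = min \<epsilon> (Min D / 3)"
  have "0 < Min D" using fD D0 by simp
  moreover have "\<delta> \<le> Min D / 3" by (simp add: \<delta>_def)
  ultimately have \<delta>: "0 < \<delta>" "\<delta> \<le> \<epsilon>" "2 * \<delta> < Min D"
    using \<epsilon> by (simp_all add: \<delta>_def)
  have sep: "2 * \<delta> < cmod (l - m)" if "l \<in> set ls" "m \<in> set ls" "l \<noteq> m" for l m
  proof -
    have "cmod (l - m) \<in> D" using that by (auto simp: D_def)
    from \<delta>(3) Min_le[OF fD this] show ?thesis by (rule less_le_trans)
  qed
  show thesis
  proof
    show "0 < \<delta>" "\<delta> \<le> \<epsilon>" by fact+
    have "norm (blockdiag N T + \<delta> *\<^sub>R Shift N) \<le> norm (blockdiag N T) + \<delta> * norm (Shift N)"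
      using norm_triangle_ineq[of "blockdiag N T" "\<delta> *\<^sub>R Shift N"] \<delta>(1) by simp
    moreover have "norm (Shift N) \<le> 1"
      by (rule norm_blinfun_bound) (simp_all add: norm_Shift_apply)
    then have "\<delta> * norm (Shift N) \<le> \<delta>" using \<delta>(1) by simp
    ultimately have "norm (blockdiag N T + \<delta> *\<^sub>R Shift N) \<le> 1"
      using norm_blockdiag[OF N, of T] nT \<delta>(2) by linarith
    moreover have "blockdiag N T + \<delta> *\<^sub>R Shift N \<in> clinear_operators"
      unfolding clinear_operators_def
      by (auto intro!: ell2_eqI simp: blinfun.add_left blinfun.scaleR_left Rep_ell2_simps
          clinear_operators_scaleC[OF A] clinear_operators_scaleC[OF Shift_clinear] algebra_simps)
    ultimately show "blockdiag N T + \<delta> *\<^sub>R Shift N \<in> B1" by (simp add: B1_def)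
    fix K x
    assume K: "K \<in> clinear_operators"
      and comm: "(blockdiag N T + \<delta> *\<^sub>R Shift N) o\<^sub>L K = K o\<^sub>L (blockdiag N T + \<delta> *\<^sub>R Shift N)"
    show "Shift N (blinfun_apply K x) = K (Shift N x)"
    proof (rule commutant_scaled_isometry[OF A Shift_clinear norm_Shift_apply blockdiag_Shift[OF N] \<delta>(1) K])
      fix y
      show "blockdiag N T (K y) + \<delta> *\<^sub>R Shift N (K y) = K (blockdiag N T y) + \<delta> *\<^sub>R K (Shift N y)"
        using arg_cong[OF comm, of "\<lambda>S. blinfun_apply S y"]
        by (simp add: blinfun.add_left blinfun.scaleR_left blinfun.add_right blinfun.scaleR_right)
      show "factors (blockdiag N T) ls (K y) = 0" "K (factors (blockdiag N T) ls y) = 0"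
        by (simp_all add: ls)
    qed (rule sep)
  qed
qed

text \<open>Entries agree along the diagonal through row \<open>b\<close> and column
  \<open>a\<close> in steps of \<open>N\<close>. It starts with modulus at least
  \<open>1 / k\<close> and later enters columns whose entries are at most half of that.\<close>

lemma pinched_not_Shift_commute:
  assumes K: "K \<in> pinched a b k M" and N: "N > 0"
    and comm: "\<And>x. Shift N (blinfun_apply K x) = K (Shift N x)"
  shows False
proof -
  have eq: "Rep_ell2 (K (ebasis (a + j * N))) (b + j * N) = Rep_ell2 (K (ebasis a)) b" for j
  proof (induction j)
    case (Suc j)
    have "K (ebasis (a + Suc j * N)) = Shift N (K (ebasis (a + j * N)))"
      by (simp add: comm Shift_ebasis ac_simps)
    with Suc show ?case by (simp add: Rep_Shift ac_simps)
  qed simp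
  \<comment> \<open>As \<open>N\<close> is positive, \<open>M\<close> steps along the diagonal are
    enough to reach the columns with small entries.\<close>
  have "M \<le> a + M * N" using N by (simp add: trans_le_add2)
  then have "real k * cmod (Rep_ell2 (K (ebasis (a + M * N))) (b + M * N)) \<le> 1 / 2"
    using K by (simp add: pinched_def)
  then show False using K unfolding eq by (simp add: pinched_def)
qed

text \<open>The approximants to \<open>T\<close> have block size \<open>j + 1\<close>, blocks cut
  from \<open>(1 - \<epsilon> j) T\<close>, and a shift term of size
  \<open>\<delta> j \<le> \<epsilon> j\<close>. Once \<open>j \<ge> n\<close>, column and row
  \<open>n\<close> are truncations of those of \<open>T\<close> up to terms tending to 0, so
  \<open>limitin_SOT_starI\<close> applies.\<close>

lemma dense_not_commuting_pinched:
  "SOT_star closure_of (B1 - {T \<in> B1. \<exists>K \<in> pinched a b k M. T o\<^sub>L K = K o\<^sub>L T}) = B1"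
    (is "_ closure_of ?G = _")
proof
  show "SOT_star closure_of ?G \<subseteq> B1"
    using closure_of_subset_topspace[of SOT_star] by (simp add: topspace_SOT_star)
  show "B1 \<subseteq> SOT_star closure_of ?G"
  proof
    fix T assume T: "T \<in> B1"
    \<comment> \<open>The double \<open>Suc\<close> keeps \<open>\<epsilon> j\<close> below 1 from
      \<open>j = 0\<close> on, so the factor \<open>1 - \<epsilon> j\<close> is positive.\<close>
    define \<epsilon> where "\<epsilon> j = inverse (real (Suc (Suc j)))" for j
    have \<epsilon>: "0 < \<epsilon> j" "\<epsilon> j < 1" for j by (simp_all add: \<epsilon>_def inverse_eq_divide)
    have \<epsilon>0: "\<epsilon> \<longlonglongrightarrow> 0"
      unfolding \<epsilon>_def using LIMSEQ_Suc[OF LIMSEQ_inverse_real_of_nat] by simp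
    define A where "A j = (1 - \<epsilon> j) *\<^sub>R T" for j
    have Acl: "A j \<in> clinear_operators" for j
      using clinear_operators_scaleC[OF B1_clinear[OF T]]
      by (auto simp: clinear_operators_def A_def blinfun.scaleR_left Rep_ell2_simps intro!: ell2_eqI)
    have nA: "norm (A j) \<le> 1 - \<epsilon> j" for j
      using mult_left_mono[OF B1_norm[OF T], of "1 - \<epsilon> j"] \<epsilon>[of j] by (simp add: A_def)
    have "\<exists>\<delta>. 0 < \<delta> \<and> \<delta> \<le> \<epsilon> j \<and> blockdiag (Suc j) (A j) + \<delta> *\<^sub>R Shift (Suc j) \<in> ?G" for j
    proof -
      obtain \<delta> where \<delta>: "0 < \<delta>" "\<delta> \<le> \<epsilon> j" "blockdiag (Suc j) (A j) + \<delta> *\<^sub>R Shift (Suc j) \<in> B1"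
        and comm: "\<And>K x. K \<in> clinear_operators \<Longrightarrow>
            (blockdiag (Suc j) (A j) + \<delta> *\<^sub>R Shift (Suc j)) o\<^sub>L K
              = K o\<^sub>L (blockdiag (Suc j) (A j) + \<delta> *\<^sub>R Shift (Suc j)) \<Longrightarrow>
            Shift (Suc j) (blinfun_apply K x) = K (Shift (Suc j) x)"
        by (rule blockdiag_plus_Shift[OF Acl nA \<epsilon>(1), where N = "Suc j"]) (simp, rule that)
      have "\<not> (\<exists>K \<in> pinched a b k M. (blockdiag (Suc j) (A j) + \<delta> *\<^sub>R Shift (Suc j)) o\<^sub>L K
          = K o\<^sub>L (blockdiag (Suc j) (A j) + \<delta> *\<^sub>R Shift (Suc j)))"
      proof
        assume "\<exists>K \<in> pinched a b k M. (blockdiag (Suc j) (A j) + \<delta> *\<^sub>R Shift (Suc j)) o\<^sub>L K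
          = K o\<^sub>L (blockdiag (Suc j) (A j) + \<delta> *\<^sub>R Shift (Suc j))"
        then obtain K where K: "K \<in> pinched a b k M"
          "(blockdiag (Suc j) (A j) + \<delta> *\<^sub>R Shift (Suc j)) o\<^sub>L K
            = K o\<^sub>L (blockdiag (Suc j) (A j) + \<delta> *\<^sub>R Shift (Suc j))" by blast
        have "K \<in> clinear_operators" using K(1) by (simp add: pinched_def)
        from pinched_not_Shift_commute[OF K(1) _ comm[OF this K(2)]] show False by simp
      qed
      with \<delta> show ?thesis by blast
    qed
    then obtain \<delta> where "\<forall>j. 0 < \<delta> j \<and> \<delta> j \<le> \<epsilon> j
        \<and> blockdiag (Suc j) (A j) + \<delta> j *\<^sub>R Shift (Suc j) \<in> ?G"
      by (rule choice[OF allI, THEN exE])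
    then have \<delta>: "0 < \<delta> j" "\<delta> j \<le> \<epsilon> j"
      and G: "blockdiag (Suc j) (A j) + \<delta> j *\<^sub>R Shift (Suc j) \<in> ?G" for j
      by blast+
    define f where "f j = blockdiag (Suc j) (A j) + \<delta> j *\<^sub>R Shift (Suc j)" for j
    have \<delta>0: "\<delta> \<longlonglongrightarrow> 0"
      by (rule Lim_null_comparison[OF _ \<epsilon>0]) (use \<delta> in \<open>simp add: abs_of_pos\<close>)
    have fG: "f j \<in> ?G" for j unfolding f_def by (rule G)
    have "limitin SOT_star f T sequentially"
    proof (rule limitin_SOT_starI[OF T])
      show "\<forall>\<^sub>F j in sequentially. f j \<in> B1" using fG by simp
      fix n
      have S0: "(\<lambda>j. \<delta> j *\<^sub>R Shift (Suc j) x) \<longlonglongrightarrow> 0" for x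
      proof (rule Lim_null_comparison)
        show "\<forall>\<^sub>F j in sequentially. norm (\<delta> j *\<^sub>R Shift (Suc j) x) \<le> \<bar>\<delta> j\<bar> * norm x"
          by (simp add: norm_Shift_apply)
        show "(\<lambda>j. \<bar>\<delta> j\<bar> * norm x) \<longlonglongrightarrow> 0"
          by (intro tendsto_mult_left_zero tendsto_rabs_zero \<delta>0)
      qed
      have 1: "(\<lambda>j. (1 - \<epsilon> j) *\<^sub>R trunc (Suc j) (T (ebasis n)) + \<delta> j *\<^sub>R Shift (Suc j) (ebasis n))
          \<longlonglongrightarrow> (1 - 0) *\<^sub>R T (ebasis n) + 0"
        by (intro tendsto_add tendsto_scaleR tendsto_diff tendsto_const \<epsilon>0 S0
            LIMSEQ_Suc[OF trunc_tendsto])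
      have 2: "\<forall>\<^sub>F j in sequentially.
          (1 - \<epsilon> j) *\<^sub>R trunc (Suc j) (T (ebasis n)) + \<delta> j *\<^sub>R Shift (Suc j) (ebasis n) = f j (ebasis n)"
        using eventually_ge_at_top[of n]
      proof eventually_elim
        case (elim j)
        have "blockdiag (Suc j) (A j) (ebasis n) = trunc (Suc j) (A j (ebasis n))"
          using blockdiag_trunc[of "Suc j" "A j" "ebasis n"] elim by (simp add: trunc_ebasis)
        also have "\<dots> = (1 - \<epsilon> j) *\<^sub>R trunc (Suc j) (T (ebasis n))"
          by (rule ell2_eqI) (simp add: A_def blinfun.scaleR_left trunc.rep_eq Rep_ell2_simps)
        finally show ?case by (simp add: f_def blinfun.add_left blinfun.scaleR_left)
      qed
      from Lim_transform_eventually[OF 1 2]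
      show "(\<lambda>j. f j (ebasis n)) \<longlonglongrightarrow> T (ebasis n)" by simp
      have 3: "(\<lambda>j. (1 - \<epsilon> j) *\<^sub>R ((coord n o\<^sub>L T) o\<^sub>L Trunc (Suc j))) \<longlonglongrightarrow> (1 - 0) *\<^sub>R (coord n o\<^sub>L T)"
        by (intro tendsto_scaleR tendsto_diff tendsto_const \<epsilon>0
            LIMSEQ_Suc[OF dual_compose_Trunc_tendsto] dual_compose coord_in_dual B1_clinear T)
      \<comment> \<open>For \<open>n \<le> j\<close> the output of the shift by \<open>j + 1\<close>
        vanishes at coordinate \<open>n\<close>, so row \<open>n\<close> has no \<delta>
        term.\<close>
      have 4: "\<forall>\<^sub>F j in sequentially.
          (1 - \<epsilon> j) *\<^sub>R ((coord n o\<^sub>L T) o\<^sub>L Trunc (Suc j)) = coord n o\<^sub>L f j"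
        using eventually_ge_at_top[of n]
      proof eventually_elim
        case (elim j)
        show ?case
        proof (rule blinfun_eqI)
          fix x
          have "Rep_ell2 (blockdiag (Suc j) (A j) x) n = Rep_ell2 (A j (trunc (Suc j) x)) n"
            using arg_cong[OF coord_blockdiag[of n "Suc j" "A j"], of "\<lambda>S. blinfun_apply S x"] elim
            by simp
          then show "((1 - \<epsilon> j) *\<^sub>R ((coord n o\<^sub>L T) o\<^sub>L Trunc (Suc j))) x = (coord n o\<^sub>L f j) x"
            using elim by (simp add: f_def A_def blinfun.add_left blinfun.scaleR_left Rep_ell2_simps Rep_Shift)
        qed
      qed
      from Lim_transform_eventually[OF 3 4]
      show "(\<lambda>j. coord n o\<^sub>L f j) \<longlonglongrightarrow> (coord n o\<^sub>L T)" by simp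
    qed
    then have ev: "\<forall>\<^sub>F j in sequentially. f j \<in> U" if "openin SOT_star U" "T \<in> U" for U
      using that by (simp add: limitin_def)
    show "T \<in> SOT_star closure_of ?G"
      unfolding in_closure_of topspace_SOT_star
    proof (intro conjI allI impI T, elim conjE)
      fix U assume "T \<in> U" "openin SOT_star U"
      from ev[OF this(2,1)] obtain j where "f j \<in> U"
        unfolding eventually_sequentially by blast
      with fG show "\<exists>y. y \<in> ?G \<and> y \<in> U" by blast
    qed
  qed
qed

section \<open>The Baire category argument\<close>

theorem theorem2p6:
  shows "typical_SOT_star (\<lambda>T. \<not> (\<exists>K. compact_operator K \<and> K \<noteq> 0 \<and> T o\<^sub>L K = K o\<^sub>L T))"
proof -
  \<comment> \<open>One dense open set for each quadruple of naturals. There are countably many, so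
    their intersection is a dense \<open>G_delta\<close> set, and by
    \<open>compact_operator_pinched\<close> its members commute with no non-zero compact
    operator.\<close>
  define G where "G = (\<lambda>(a, b, k, M). B1 - {T \<in> B1. \<exists>K \<in> pinched a b k M. T o\<^sub>L K = K o\<^sub>L T})"
  have G: "openin SOT_star (G p)" "SOT_star closure_of G p = B1" for p
    using openin_diff[OF openin_topspace closedin_commuting_pinched]
    by (cases p; simp add: G_def topspace_SOT_star dense_not_commuting_pinched)+
  obtain X d where "Metric_space X d" and mc: "Metric_space.mcomplete X d"
    and X: "SOT_star = Metric_space.mtopology X d"
    using completely_metrizable_SOT_star unfolding completely_metrizable_space_def by blast
  interpret Metric_space X d by fact
  have XB: "X = B1" using topspace_SOT_star unfolding X topspace_mtopology .
  have dense: "SOT_star closure_of \<Inter>(range G) = topspace SOT_star"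
    unfolding X topspace_mtopology
    by (rule metric_Baire_category[OF mc]) (use G X XB in auto)
  have gdelta: "gdelta_in SOT_star (\<Inter>(range G))"
    by (rule gdelta_in_Inter) (use G(1) in \<open>auto intro: open_imp_gdelta_in\<close>)
  have "\<Inter>(range G) \<subseteq> {T \<in> B1. \<not> (\<exists>K. compact_operator K \<and> K \<noteq> 0 \<and> T o\<^sub>L K = K o\<^sub>L T)}"
  proof (intro subsetI CollectI conjI notI)
    fix T assume T: "T \<in> \<Inter>(range G)"
    then have T': "T \<in> G (a, b, k, M)" for a b k M by blast
    then show "T \<in> B1" by (simp add: G_def)
    assume "\<exists>K. compact_operator K \<and> K \<noteq> 0 \<and> T o\<^sub>L K = K o\<^sub>L T"
    then obtain K where K: "compact_operator K" "K \<noteq> 0" "T o\<^sub>L K = K o\<^sub>L T" by blast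
    obtain a b k M where "K \<in> pinched a b k M" by (rule compact_operator_pinched[OF K(1,2)])
    then show False using T'[of a b k M] K(3) by (auto simp: G_def)
  qed
  with dense gdelta show ?thesis
    unfolding typical_SOT_star_def comeager_in_def topspace_SOT_star by blast
qed

end
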